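(* Let $(R,\mathfrak m)$ be a commutative Noetherian local ring. If $M\in\Omega\operatorname{Deep}(R)\cap\operatorname{DF}(R)$, then $R$ is a direct summand of $M$.
   Context: All modules are finitely generated. For a Noetherian local ring $R$ with $\operatorname{depth} R=t$: - $\operatorname{Deep}(R)$ is the class of $R$-modules $X$ with $\operatorname{depth} X\ge t$ (the zero module has depth $\infty$). - $\Omega\operatorname{Deep}(R)$ is the class of $R$-modules $M$ for which there is an exact sequence $0\to M\to R^n\to X\to 0$ with $n\in\mathbb N$ and $X\in\operatorname{Deep}(R)$. - $\operatorname{DF}(R)$ is the class of $R$-modules $M$ for which there is an exact sequence $0\to R\to M^n\to X\to 0$ with $n\in\mathbb N$ and $X\in\operatorname{Deep}(R)$. *)

theory Defs
  imports "HOL-Algebra.Ring_Divisibility" "HOL-Library.Extended_Nat"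
    "Jordan_Normal_Form.Missing_VectorSpace"
begin

text \<open>Modules are those of HOL-Algebra; \<open>module_hom\<close>, \<open>direct_sum\<close> and
  \<open>span\<close> are those of the AFP entry VectorSpace. The record fields \<open>mult\<close> and \<open>one\<close>
  of a module carry no meaning.\<close>

locale noetherian_local_ring = cring R + noetherian_ring R for R (structure) +
  fixes \<mm> :: "'a set"
  assumes maximalideal_iff: "maximalideal J R \<longleftrightarrow> J = \<mm>"

definition ring_module :: "('a, 'k) ring_scheme \<Rightarrow> ('a, 'a) module" where
  "ring_module R = \<lparr>carrier = carrier R, mult = mult R, one = one R,
     zero = zero R, add = add R, smult = mult R\<rparr>"

definition module_power :: "('a, 'b, 'k) module_scheme \<Rightarrow> nat \<Rightarrow> ('a, nat \<Rightarrow> 'b) module" where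
  "module_power M n = \<lparr>carrier = {..<n} \<rightarrow>\<^sub>E carrier M,
     mult = (\<lambda>v w. \<lambda>i\<in>{..<n}. \<zero>\<^bsub>M\<^esub>), one = (\<lambda>i\<in>{..<n}. \<zero>\<^bsub>M\<^esub>),
     zero = (\<lambda>i\<in>{..<n}. \<zero>\<^bsub>M\<^esub>),
     add = (\<lambda>v w. \<lambda>i\<in>{..<n}. v i \<oplus>\<^bsub>M\<^esub> w i),
     smult = (\<lambda>a v. \<lambda>i\<in>{..<n}. a \<odot>\<^bsub>M\<^esub> v i)\<rparr>"

lemma ring_module_is_module:
  assumes "cring R" shows "module R (ring_module R)"
proof -
  interpret cring R by fact
  show ?thesis
    by (intro module_criteria)
      (auto simp: ring_module_def assms m_assoc l_distr r_distr a_ac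
        intro: bexI[OF _ a_inv_closed] r_neg)
qed

lemma module_power_is_module:
  assumes "module R M" shows "module R (module_power M n)"
proof -
  interpret module R M by fact
  show ?thesis
    apply (intro module_criteria)
               apply (auto simp: module_power_def PiE_iff extensional_def R.is_cring smult_l_distr
                 smult_r_distr smult_assoc1 M.a_ac restrict_def fun_eq_iff)
    subgoal for v
      by (rule bexI[of _ "\<lambda>i\<in>{..<n}. \<ominus>\<^bsub>M\<^esub> v i"]) (auto simp: M.r_neg restrict_def split: if_splits)
    done
qed

definition fg_module :: "('a, 'k) ring_scheme \<Rightarrow> ('a, 'b, 'l) module_scheme \<Rightarrow> bool" where
  "fg_module R M \<longleftrightarrow> module R M \<and>
     (\<exists>S. finite S \<and> S \<subseteq> carrier M \<and> module.span R M S = carrier M)"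

definition module_isomorphic ::
  "('a, 'k) ring_scheme \<Rightarrow> ('a, 'b, 'l) module_scheme \<Rightarrow> ('a, 'c, 'm) module_scheme \<Rightarrow> bool" where
  "module_isomorphic R M N \<longleftrightarrow>
     (\<exists>f \<in> module_hom R M N. bij_betw f (carrier M) (carrier N))"

text \<open>Exactness of \<open>0 \<rightarrow> A \<rightarrow> B \<rightarrow> C \<rightarrow> 0\<close> with maps \<open>f\<close> and \<open>g\<close>.\<close>

definition short_exact ::
  "('a, 'k) ring_scheme \<Rightarrow> ('a, 'b, 'l) module_scheme \<Rightarrow> ('a, 'c, 'm) module_scheme \<Rightarrow>
   ('a, 'd, 'n) module_scheme \<Rightarrow> ('b \<Rightarrow> 'c) \<Rightarrow> ('c \<Rightarrow> 'd) \<Rightarrow> bool" where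
  "short_exact R A B C f g \<longleftrightarrow>
     f \<in> module_hom R A B \<and> g \<in> module_hom R B C \<and>
     inj_on f (carrier A) \<and>
     f ` carrier A = {v \<in> carrier B. g v = \<zero>\<^bsub>C\<^esub>} \<and>
     g ` carrier B = carrier C"

text \<open>For \<open>xs = [x\<^sub>1, \<dots>, x\<^sub>r]\<close> this is the submodule \<open>(x\<^sub>1, \<dots>, x\<^sub>r) M\<close>.\<close>

definition list_smult :: "('a, 'k) ring_scheme \<Rightarrow> 'a list \<Rightarrow> ('a, 'b, 'l) module_scheme \<Rightarrow> 'b set" where
  "list_smult R xs M = module.span R M {x \<odot>\<^bsub>M\<^esub> v | x v. x \<in> set xs \<and> v \<in> carrier M}"

text \<open>\<open>M\<close>-regular sequences: \<open>x\<^sub>i\<close> is a nonzerodivisor on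
  \<open>M / (x\<^sub>1, \<dots>, x\<^bsub>i-1\<^esub>) M\<close> for all \<open>i\<close>, and \<open>M \<noteq> (x\<^sub>1, \<dots>, x\<^sub>r) M\<close>.\<close>

definition regular_sequence ::
  "('a, 'k) ring_scheme \<Rightarrow> ('a, 'b, 'l) module_scheme \<Rightarrow> 'a list \<Rightarrow> bool" where
  "regular_sequence R M xs \<longleftrightarrow>
     set xs \<subseteq> carrier R \<and>
     (\<forall>i < length xs. \<forall>v \<in> carrier M.
        (xs ! i) \<odot>\<^bsub>M\<^esub> v \<in> list_smult R (take i xs) M \<longrightarrow> v \<in> list_smult R (take i xs) M) \<and>
     list_smult R xs M \<noteq> carrier M"

text \<open>The depth over a local ring with maximal ideal \<open>\<mm>\<close>; only meaningful for finitely
  generated \<open>M\<close>.\<close>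

definition depth ::
  "('a, 'k) ring_scheme \<Rightarrow> 'a set \<Rightarrow> ('a, 'b, 'l) module_scheme \<Rightarrow> enat" where
  "depth R \<mm> M = (if carrier M = {\<zero>\<^bsub>M\<^esub>} then \<infinity>
     else Sup {enat (length xs) | xs. set xs \<subseteq> \<mm> \<and> regular_sequence R M xs})"

definition Deep :: "('a, 'k) ring_scheme \<Rightarrow> 'a set \<Rightarrow> ('a, 'b) module set" where
  "Deep R \<mm> = {X. fg_module R X \<and> depth R \<mm> X \<ge> depth R \<mm> (ring_module R)}"

text \<open>In the two classes below \<open>X\<close> is a quotient of \<open>R\<^sup>n\<close>, respectively \<open>M\<^sup>n\<close>, so up to
  isomorphism its carrier is a set of cosets. Hence letting \<open>X\<close> range over modules whose elements
  have type \<open>(nat \<Rightarrow> _) set\<close> loses no generality; \<open>Omega_DeepI\<close> and \<open>DFI\<close> prove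
  that an \<open>X\<close> of any other type is equally good.\<close>

definition Omega_Deep :: "('a, 'k) ring_scheme \<Rightarrow> 'a set \<Rightarrow> ('a, 'b) module set" where
  "Omega_Deep R \<mm> = {M. fg_module R M \<and>
     (\<exists>n. \<exists>X \<in> (Deep R \<mm> :: ('a, (nat \<Rightarrow> 'a) set) module set). \<exists>f g.
        short_exact R M (module_power (ring_module R) n) X f g)}"

definition DF :: "('a, 'k) ring_scheme \<Rightarrow> 'a set \<Rightarrow> ('a, 'b) module set" where
  "DF R \<mm> = {M. fg_module R M \<and>
     (\<exists>n. \<exists>X \<in> (Deep R \<mm> :: ('a, (nat \<Rightarrow> 'b) set) module set). \<exists>f g.
        short_exact R (ring_module R) (module_power M n) X f g)}"

text \<open>A complement of a summand of \<open>M\<close> embeds in \<open>M\<close>, so its elements may be given the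
  type of those of \<open>M\<close>.\<close>

definition direct_summand ::
  "('a, 'k) ring_scheme \<Rightarrow> ('a, 'c, 'l) module_scheme \<Rightarrow> ('a, 'b, 'm) module_scheme \<Rightarrow> bool" where
  "direct_summand R L M \<longleftrightarrow>
     (\<exists>N :: ('a, 'b) module. module R N \<and> module_isomorphic R M (direct_sum L N))"

subsection \<open>Independence of the type chosen for the cokernels\<close>

lemma span_transport:
  assumes "mod_hom R M N f" and "bij_betw f (carrier M) (carrier N)" and "S \<subseteq> carrier M"
  shows "module.span R N (f ` S) = f ` module.span R M S"
proof -
  interpret mod_hom R M N f by fact
  have inj: "inj_on f S"
    using assms(2,3) by (meson bij_betw_imp_inj_on inj_on_subset)
  have lc: "f (M.lincomb a A) = N.lincomb (\<lambda>w. a (inv_into S f w)) (f ` A)"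
    if A: "A \<subseteq> S" "finite A" "a \<in> A \<rightarrow> carrier R" for a A
  proof -
    have AM: "A \<subseteq> carrier M" using A assms(3) by blast
    have injA: "inj_on f A" using inj A by (meson inj_on_subset)
    have "f (M.lincomb a A) = (\<Oplus>\<^bsub>N\<^esub>v\<in>A. f (a v \<odot>\<^bsub>M\<^esub> v))"
      unfolding M.lincomb_def using AM A by (intro hom_sum) auto
    also have "\<dots> = (\<Oplus>\<^bsub>N\<^esub>v\<in>A. a (inv_into S f (f v)) \<odot>\<^bsub>N\<^esub> f v)"
      using AM A inj by (intro N.M.finsum_cong') (auto simp: Pi_iff subset_iff)
    also have "\<dots> = (\<Oplus>\<^bsub>N\<^esub>w\<in>f ` A. a (inv_into S f w) \<odot>\<^bsub>N\<^esub> w)"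
      using AM A inj injA by (intro N.M.finsum_reindex[symmetric]) (auto simp: Pi_iff subset_iff)
    finally show ?thesis unfolding N.lincomb_def .
  qed
  show ?thesis
  proof
    show "f ` M.span S \<subseteq> N.span (f ` S)"
    proof
      fix w assume "w \<in> f ` M.span S"
      then obtain a A where A: "A \<subseteq> S" "finite A" "a \<in> A \<rightarrow> carrier R" "w = f (M.lincomb a A)"
        unfolding M.span_def by auto
      have "(\<lambda>w. a (inv_into S f w)) \<in> f ` A \<rightarrow> carrier R"
        using A inj by (auto simp: Pi_iff subset_iff)
      then show "w \<in> N.span (f ` S)"
        unfolding N.span_def using A lc[OF A(1-3)] by blast
    qed
    show "N.span (f ` S) \<subseteq> f ` M.span S"
    proof
      fix w assume "w \<in> N.span (f ` S)"
      then obtain b B where B: "B \<subseteq> f ` S" "finite B" "b \<in> B \<rightarrow> carrier R" "w = N.lincomb b B"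
        unfolding N.span_def by auto
      obtain A where A: "A \<subseteq> S" "finite A" "B = f ` A"
        using B finite_subset_image by metis
      have 1: "(\<lambda>v. b (f v)) \<in> A \<rightarrow> carrier R" using A B by auto
      have "f (M.lincomb (\<lambda>v. b (f v)) A) = N.lincomb (\<lambda>w. b (f (inv_into S f w))) (f ` A)"
        using lc[OF A(1,2) 1] .
      also have "\<dots> = N.lincomb b B"
        unfolding N.lincomb_def A(3)
      proof (intro N.M.finsum_cong' refl)
        have BN: "B \<subseteq> carrier N" using B(1) assms(3) by auto
        show "(\<lambda>w. b w \<odot>\<^bsub>N\<^esub> w) \<in> f ` A \<rightarrow> carrier N"
          using BN B(3) A(3) by blast
        show "b (f (inv_into S f w)) \<odot>\<^bsub>N\<^esub> w = b w \<odot>\<^bsub>N\<^esub> w" if "w \<in> f ` A" for w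
          using that A(3) B(1) by (metis f_inv_into_f subsetD)
      qed
      finally have "w = f (M.lincomb (\<lambda>v. b (f v)) A)" using B(4) by simp
      moreover have "M.lincomb (\<lambda>v. b (f v)) A \<in> M.span S"
        unfolding M.span_def using A(1,2) 1 by (intro CollectI exI conjI) (rule refl)
      ultimately show "w \<in> f ` M.span S" by (rule image_eqI)
    qed
  qed
qed

lemma list_smult_transport:
  assumes "mod_hom R M N f" and "bij_betw f (carrier M) (carrier N)" and "set xs \<subseteq> carrier R"
  shows "list_smult R xs N = f ` list_smult R xs M"
proof -
  interpret mod_hom R M N f by fact
  have "f ` {x \<odot>\<^bsub>M\<^esub> v | x v. x \<in> set xs \<and> v \<in> carrier M} =
      {x \<odot>\<^bsub>N\<^esub> v | x v. x \<in> set xs \<and> v \<in> carrier N}" (is "?l = ?r")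
  proof
    show "?l \<subseteq> ?r"
    proof
      fix w assume "w \<in> ?l"
      then obtain x v where x: "x \<in> set xs" and v: "v \<in> carrier M"
        and w: "w = f (x \<odot>\<^bsub>M\<^esub> v)" by blast
      have "x \<in> carrier R" using x assms(3) by blast
      then have "w = x \<odot>\<^bsub>N\<^esub> f v" using v w by simp
      then show "w \<in> ?r" using x f_im[OF v] by blast
    qed
    show "?r \<subseteq> ?l"
    proof
      fix w assume "w \<in> ?r"
      then obtain x u where x: "x \<in> set xs" and u: "u \<in> carrier N" "w = x \<odot>\<^bsub>N\<^esub> u"
        by blast
      obtain v where v: "v \<in> carrier M" "u = f v"
        using u(1) bij_betw_imp_surj_on[OF assms(2)] by auto
      have xR: "x \<in> carrier R" using x assms(3) by blast
      have "w = f (x \<odot>\<^bsub>M\<^esub> v)" using u(2) v xR by simp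
      then show "w \<in> ?l" using x v(1) by (intro image_eqI[of _ _ "x \<odot>\<^bsub>M\<^esub> v"]) auto
    qed
  qed
  then show ?thesis
    unfolding list_smult_def using assms
    by (subst span_transport[OF assms(1,2), symmetric]) (auto simp: subset_iff)
qed

lemma regular_sequence_transport:
  assumes "mod_hom R M N f" and f: "bij_betw f (carrier M) (carrier N)"
    and reg: "regular_sequence R M xs"
  shows "regular_sequence R N xs"
proof -
  interpret mod_hom R M N f by fact
  have xs: "set xs \<subseteq> carrier R" using reg by (simp add: regular_sequence_def)
  have inj: "inj_on f (carrier M)" and surj: "f ` carrier M = carrier N"
    using f by (auto simp: bij_betw_def)
  have sub: "list_smult R ys M \<subseteq> carrier M" if "set ys \<subseteq> carrier R" for ys
    unfolding list_smult_def using that by (intro M.span_is_subset2) (auto simp: subset_iff)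
  have iff: "f v \<in> list_smult R ys N \<longleftrightarrow> v \<in> list_smult R ys M"
    if "set ys \<subseteq> carrier R" "v \<in> carrier M" for ys v
    using list_smult_transport[OF assms(1,2)] that inj sub by (simp add: inj_on_image_mem_iff)
  have tk: "set (take i xs) \<subseteq> carrier R" for i
    using xs set_take_subset by fast
  show ?thesis
    unfolding regular_sequence_def
  proof (intro conjI allI impI ballI)
    show "set xs \<subseteq> carrier R" by fact
    show "list_smult R xs N \<noteq> carrier N"
      using reg list_smult_transport[OF assms(1,2) xs] surj inj sub[OF xs]
      by (metis inj_on_image_eq_iff order_refl regular_sequence_def)
    fix i v assume i: "i < length xs" and v: "v \<in> carrier N"
      and h: "xs ! i \<odot>\<^bsub>N\<^esub> v \<in> list_smult R (take i xs) N"
    obtain u where u: "u \<in> carrier M" "v = f u" using v surj by auto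
    have xi: "xs ! i \<in> carrier R" using xs i nth_mem by blast
    have "f (xs ! i \<odot>\<^bsub>M\<^esub> u) \<in> list_smult R (take i xs) N" using h u xi by simp
    then have "xs ! i \<odot>\<^bsub>M\<^esub> u \<in> list_smult R (take i xs) M"
      using iff[OF tk M.smult_closed[OF xi u(1)]] by blast
    then have "u \<in> list_smult R (take i xs) M"
      using reg i u by (auto simp: regular_sequence_def)
    then show "v \<in> list_smult R (take i xs) N" using iff[OF tk] u by simp
  qed
qed

lemma Deep_transport:
  fixes X :: "('a, 'b) module" and Y :: "('a, 'c) module"
  assumes "mod_hom R X Y f" and f: "bij_betw f (carrier X) (carrier Y)" and X: "X \<in> Deep R \<mm>"
  shows "Y \<in> Deep R \<mm>"
proof -
  interpret mod_hom R X Y f by fact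
  obtain S where S: "finite S" "S \<subseteq> carrier X" "M.span S = carrier X"
    using X by (auto simp: Deep_def fg_module_def)
  have "N.span (f ` S) = carrier Y"
    using span_transport[OF assms(1,2) S(2)] S f by (simp add: bij_betw_def)
  moreover have "f ` S \<subseteq> carrier Y" using S by auto
  ultimately have fg: "fg_module R Y"
    unfolding fg_module_def using S(1) N.module_axioms by blast
  have z: "carrier Y = {\<zero>\<^bsub>Y\<^esub>}" if "carrier X = {\<zero>\<^bsub>X\<^esub>}"
    using f that by (auto simp: bij_betw_def)
  have "depth R \<mm> X \<le> depth R \<mm> Y"
  proof (cases "carrier Y = {\<zero>\<^bsub>Y\<^esub>}")
    case False
    then have "carrier X \<noteq> {\<zero>\<^bsub>X\<^esub>}" using z by blast
    then show ?thesis
      unfolding depth_def using False regular_sequence_transport[OF assms(1,2)]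
      by (auto intro!: Sup_subset_mono)
  qed (simp add: depth_def)
  then show ?thesis using X fg unfolding Deep_def by auto
qed

lemma cokernel_transport:
  fixes F :: "('a, 'f) module" and X :: "('a, 'x) module"
  assumes F: "module R F" and ex: "short_exact R A F X f g" and X: "X \<in> Deep R \<mm>"
  shows "\<exists>Y \<in> (Deep R \<mm> :: ('a, 'f set) module set). \<exists>h. short_exact R A F Y f h"
proof -
  interpret F: module R F by fact
  interpret X: module R X using X by (simp add: Deep_def fg_module_def)
  define \<phi> where "\<phi> x = {v \<in> carrier F. g v = x}" for x
  have g: "g ` carrier F = carrier X" "g \<in> module_hom R F X"
    using ex by (auto simp: short_exact_def)
  have inj: "inj_on \<phi> (carrier X)"
  proof (rule inj_onI)
    fix x y assume x: "x \<in> carrier X" and eq: "\<phi> x = \<phi> y"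
    obtain v where v: "v \<in> carrier F" "g v = x" using x g(1) by (metis imageE)
    then have "v \<in> \<phi> y" using eq by (auto simp: \<phi>_def)
    then show "x = y" using v by (simp add: \<phi>_def)
  qed
  define \<psi> where "\<psi> = inv_into (carrier X) \<phi>"
  have \<psi>: "\<psi> (\<phi> x) = x" if "x \<in> carrier X" for x
    using inj that by (simp add: \<psi>_def)
  define Y :: "('a, 'f set) module" where
    "Y = \<lparr>carrier = \<phi> ` carrier X, mult = (\<lambda>a b. a), one = \<phi> \<zero>\<^bsub>X\<^esub>, zero = \<phi> \<zero>\<^bsub>X\<^esub>,
       add = (\<lambda>a b. \<phi> (\<psi> a \<oplus>\<^bsub>X\<^esub> \<psi> b)), smult = (\<lambda>a b. \<phi> (a \<odot>\<^bsub>X\<^esub> \<psi> b))\<rparr>"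
  have Y: "module R Y"
    apply (intro module_criteria)
               apply (auto simp: Y_def \<psi> F.R.is_cring X.a_ac X.smult_l_distr X.smult_r_distr
                 X.smult_assoc1)
    subgoal for x by (rule bexI[of _ "\<ominus>\<^bsub>X\<^esub> x"]) (auto simp: \<psi> X.r_neg)
    done
  have hom: "\<phi> \<in> module_hom R X Y"
    by (auto simp: module_hom_def Y_def \<psi>)
  have bij: "bij_betw \<phi> (carrier X) (carrier Y)"
    using inj by (simp add: bij_betw_def Y_def)
  have mh: "mod_hom R X Y \<phi>"
    by (intro mod_hom.intro mod_hom_axioms.intro X.module_axioms Y hom)
  have "Y \<in> Deep R \<mm>" using Deep_transport[OF mh bij X] .
  moreover have "short_exact R A F Y f (\<phi> \<circ> g)"
  proof -
    have "\<phi> \<circ> g \<in> module_hom R F Y"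
      using g(2) by (auto simp: module_hom_def Y_def \<psi> Pi_iff)
    moreover have "{v \<in> carrier F. (\<phi> \<circ> g) v = \<zero>\<^bsub>Y\<^esub>} = {v \<in> carrier F. g v = \<zero>\<^bsub>X\<^esub>}"
    proof -
      have "g v = \<zero>\<^bsub>X\<^esub>" if "v \<in> carrier F" "\<phi> (g v) = \<phi> \<zero>\<^bsub>X\<^esub>" for v
        using that g(1) inj_onD[OF inj] X.zero_closed by blast
      then show ?thesis by (auto simp: Y_def)
    qed
    moreover have "(\<phi> \<circ> g) ` carrier F = carrier Y"
      unfolding image_comp[symmetric] g(1) by (simp add: Y_def)
    ultimately show ?thesis using ex by (simp add: short_exact_def)
  qed
  ultimately show ?thesis by blast
qed

lemma Omega_DeepI:
  fixes M :: "('a, 'b) module" and X :: "('a, 'x) module"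
  assumes "cring R" and "fg_module R M" and "X \<in> Deep R \<mm>"
    and "short_exact R M (module_power (ring_module R) n) X f g"
  shows "M \<in> Omega_Deep R \<mm>"
proof -
  have "\<exists>Y \<in> (Deep R \<mm> :: ('a, (nat \<Rightarrow> 'a) set) module set). \<exists>h.
      short_exact R M (module_power (ring_module R) n) Y f h"
    by (intro cokernel_transport[OF _ assms(4,3)] module_power_is_module ring_module_is_module
        assms(1))
  then show ?thesis unfolding Omega_Deep_def using assms(2) by auto
qed

lemma DFI:
  fixes M :: "('a, 'b) module" and X :: "('a, 'x) module"
  assumes "fg_module R M" and "X \<in> Deep R \<mm>"
    and "short_exact R (ring_module R) (module_power M n) X f g"
  shows "M \<in> DF R \<mm>"
proof -
  have M: "module R M" using assms(1) by (simp add: fg_module_def)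
  have "\<exists>Y \<in> (Deep R \<mm> :: ('a, (nat \<Rightarrow> 'b) set) module set). \<exists>h.
      short_exact R (ring_module R) (module_power M n) Y f h"
    by (intro cokernel_transport[OF _ assms(3,2)] module_power_is_module M)
  then show ?thesis unfolding DF_def using assms(1) by auto
qed

end

theory Submission
  imports Defs
begin

text \<open>Let \<open>H\<^sup>i(N)\<close> denote the cohomology of the complex of all functions from words over \<open>\<mm>\<close> to a
  module \<open>N\<close>, with the Koszul differential. It is a cohomological functor in \<open>N\<close>, it is
  annihilated by \<open>\<mm>\<close>, and \<open>H\<^sup>0(N)\<close> is the socle of \<open>N\<close>; hence it detects depth just as
  \<open>Ext(R/\<mm>, N)\<close> does: \<open>H\<^sup>i(N) = 0\<close> for \<open>i < depth N\<close>, and \<open>H\<^sup>r(R) \<noteq> 0\<close> for the length \<open>r\<close> of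
  a maximal \<open>R\<close>-regular sequence in \<open>\<mm>\<close>. Since the cokernels in the two exact sequences have depth
  at least \<open>r\<close>, the maps \<open>R \<rightarrow> M\<^sup>n\<close> and \<open>M \<rightarrow> R\<^sup>p\<close> are injective on \<open>H\<^sup>r\<close>. If the image of
  \<open>M\<close> were contained in \<open>\<mm> R\<^sup>p\<close>, all components \<open>R \<rightarrow> M \<rightarrow> R\<close> of the composite would be
  multiplications by elements of \<open>\<mm>\<close>, hence zero on \<open>H\<^sup>r\<close>, and \<open>H\<^sup>r(R)\<close> would vanish. So some
  component \<open>M \<rightarrow> R\<close> takes a unit value and splits off \<open>R\<close>.\<close>

subsection \<open>Annihilators in Noetherian rings\<close>

text \<open>Zorn's lemma on the members of \<open>S\<close> above \<open>I\<close>. A nonempty chain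
  of ideals in a Noetherian ring contains its own union, so the upper bound of the chain lies in
  \<open>S\<close> whatever \<open>S\<close> is.\<close>

lemma (in noetherian_ring) exists_maximal_in_ideals:
  assumes "S \<subseteq> {I. ideal I R}" and "I \<in> S"
  shows "\<exists>J \<in> S. I \<subseteq> J \<and> (\<forall>K \<in> S. J \<subseteq> K \<longrightarrow> K = J)"
proof -
  let ?S = "{K \<in> S. I \<subseteq> K}"
  have "\<exists>J \<in> ?S. \<forall>K \<in> ?S. J \<subseteq> K \<longrightarrow> K = J"
  proof (rule subset_Zorn_nonempty)
    show "?S \<noteq> {}" using assms(2) by blast
    fix C assume C: "C \<noteq> {}" "subset.chain ?S C"
    then have CS: "C \<subseteq> ?S" and lin: "\<forall>x\<in>C. \<forall>y\<in>C. x \<subseteq> y \<or> y \<subseteq> x"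
      by (simp_all add: subset_chain_def)
    from CS assms(1) have "C \<subseteq> {I. ideal I R}" by blast
    with lin have "subset.chain {I. ideal I R} C" by (simp add: subset_chain_def)
    then have "\<Union>C \<in> C" by (rule ideal_chain_is_trivial[OF C(1)])
    then show "\<Union>C \<in> ?S" using CS by (rule_tac subsetD)
  qed
  then obtain J where J: "J \<in> ?S" and max: "\<forall>K \<in> ?S. J \<subseteq> K \<longrightarrow> K = J" by (elim bexE)
  have "K = J" if "K \<in> S" "J \<subseteq> K" for K
    using max that J by (simp add: order_trans[of I J K])
  then show ?thesis using J by (intro bexI[of _ J]) simp_all
qed

section \<open>Colon ideals, products in prime ideals, prime avoidance\<close>

context cring
begin

lemma ideal_colon:
  assumes "ideal L R" and "v \<in> carrier R"
  shows "ideal {y \<in> carrier R. y \<otimes> v \<in> L} R"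
proof -
  interpret L: ideal L R by fact
  have neg: "(\<ominus> a) \<otimes> v \<in> L" if "a \<in> carrier R" "a \<otimes> v \<in> L" for a
    using that assms(2) by (simp add: l_minus)
  have "x \<otimes> a \<otimes> v \<in> L" if "a \<in> carrier R" "a \<otimes> v \<in> L" "x \<in> carrier R" for a x
    using that assms(2) L.I_l_closed[of "a \<otimes> v" x] by (simp add: m_assoc)
  moreover have "a \<otimes> x \<otimes> v \<in> L" if "a \<in> carrier R" "a \<otimes> v \<in> L" "x \<in> carrier R" for a x
    using that assms(2) L.I_l_closed[of "a \<otimes> v" x] by (simp add: m_lcomm m_assoc m_comm)
  ultimately show ?thesis
    using neg assms(2)
    by (intro idealI ring_axioms subgroup.intro)
      (auto simp: l_distr a_inv_def[symmetric])
qed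

text \<open>If b v is outside \<open>L\<close>, its colon ideal contains that of \<open>v\<close>,
  hence equals it by maximality. So a b v in \<open>L\<close> already gives a v in
  \<open>L\<close>.\<close>

lemma primeideal_of_maximal_colon:
  assumes L: "ideal L R" and v: "v \<in> carrier R - L"
    and max: "\<And>w. w \<in> carrier R - L \<Longrightarrow> {y \<in> carrier R. y \<otimes> v \<in> L} \<subseteq> {y \<in> carrier R. y \<otimes> w \<in> L} \<Longrightarrow>
      {y \<in> carrier R. y \<otimes> w \<in> L} = {y \<in> carrier R. y \<otimes> v \<in> L}"
  shows "primeideal {y \<in> carrier R. y \<otimes> v \<in> L} R" (is "primeideal ?P R")
proof (rule primeidealI)
  interpret L: ideal L R by fact
  show "ideal ?P R" using ideal_colon[OF L] v by blast
  show "cring R" ..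
  have "\<one> \<notin> ?P" using v by simp
  then show "carrier R \<noteq> ?P" using one_closed by blast
  fix a b assume a: "a \<in> carrier R" and b: "b \<in> carrier R" and ab: "a \<otimes> b \<in> ?P"
  show "a \<in> ?P \<or> b \<in> ?P"
  proof (rule disjCI)
    assume "b \<notin> ?P"
    then have bv: "b \<otimes> v \<in> carrier R - L" using b v by blast
    have "?P \<subseteq> {y \<in> carrier R. y \<otimes> (b \<otimes> v) \<in> L}"
    proof
      fix y assume y: "y \<in> ?P"
      then have "b \<otimes> (y \<otimes> v) \<in> L" using b by (simp add: L.I_l_closed)
      then show "y \<in> {y \<in> carrier R. y \<otimes> (b \<otimes> v) \<in> L}" using y b v by (simp add: m_lcomm)
    qed
    from max[OF bv this] show "a \<in> ?P" using a ab b v by (auto simp: m_assoc)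
  qed
qed

lemma primeideal_prod_mem:
  assumes P: "primeideal P R" and "finite F" and "f \<in> F \<rightarrow> carrier R" and "finprod R f F \<in> P"
  shows "\<exists>i \<in> F. f i \<in> P"
  using assms(2-4)
proof (induction F rule: finite_induct)
  case empty
  interpret P: primeideal P R by fact
  show ?case using empty P.I_notcarr P.one_imp_carrier by simp
next
  case (insert i F)
  interpret P: primeideal P R by fact
  have "f i \<otimes> finprod R f F \<in> P" using insert by (simp add: Pi_iff)
  then have "f i \<in> P \<or> finprod R f F \<in> P"
    using insert.prems by (intro P.I_prime) (auto simp: Pi_iff)
  then show ?case using insert by auto
qed

lemma ideal_finprod_mem:
  assumes I: "ideal I R" and "finite F" and "f \<in> F \<rightarrow> carrier R" and "i \<in> F" and "f i \<in> I"
  shows "finprod R f F \<in> I"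
proof -
  interpret I: ideal I R by fact
  have "finprod R f (insert i (F - {i})) = f i \<otimes> finprod R f (F - {i})"
    using assms by (intro finprod_insert) auto
  moreover have "finprod R f (F - {i}) \<in> carrier R" using assms by (intro finprod_closed) auto
  ultimately show ?thesis using assms(4,5) by (simp add: insert_absorb I.I_r_closed)
qed

text \<open>Choosing an element outside \<open>P\<close> in each \<open>I\<close>, the product lies
  in every \<open>I\<close> but not in the prime \<open>P\<close>. Intersecting with
  \<open>carrier R\<close> covers the case of empty \<open>F\<close>, where \<open>\<Inter>F\<close>
  is the whole type.\<close>

lemma primeideal_finite_Inter:
  assumes P: "primeideal P R" and F: "finite F" "\<And>I. I \<in> F \<Longrightarrow> ideal I R"
    and sub: "carrier R \<inter> \<Inter>F \<subseteq> P"
  shows "\<exists>I \<in> F. I \<subseteq> P"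
proof (rule ccontr)
  assume "\<not> ?thesis"
  then have "\<forall>I\<in>F. \<exists>x. x \<in> I \<and> x \<notin> P" by blast
  then obtain x where x: "\<And>I. I \<in> F \<Longrightarrow> x I \<in> I" "\<And>I. I \<in> F \<Longrightarrow> x I \<notin> P" by metis
  have xR: "x \<in> F \<rightarrow> carrier R" using x(1) F(2) by (auto intro: ideal.Icarr)
  then have "finprod R x F \<in> carrier R \<inter> \<Inter>F"
    using ideal_finprod_mem[OF F(2) F(1) xR _ x(1)] finprod_closed[OF xR]
    by (intro IntI InterI) simp_all
  then show False using primeideal_prod_mem[OF P F(1) xR] sub x(2) by blast
qed

lemma prime_avoidance:
  assumes "finite \<P>" and "\<And>P. P \<in> \<P> \<Longrightarrow> primeideal P R"
    and "ideal I R" and "I \<subseteq> \<Union>\<P>"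
  shows "\<exists>P \<in> \<P>. I \<subseteq> P"
  using assms
proof (induction \<P> rule: finite_psubset_induct)
  case (psubset \<P>)
  interpret I: ideal I R by fact
  show ?case
  proof (cases "\<exists>P \<in> \<P>. I \<subseteq> \<Union>(\<P> - {P})")
    case True
    then obtain P where P: "P \<in> \<P>" "I \<subseteq> \<Union>(\<P> - {P})" by blast
    have "\<exists>Q \<in> \<P> - {P}. I \<subseteq> Q" using P psubset.prems by (intro psubset.IH) auto
    then show ?thesis by blast
  next
    case False
    then have "\<forall>P\<in>\<P>. \<exists>x. x \<in> I \<and> x \<notin> \<Union>(\<P> - {P})" by blast
    then obtain x where x0: "\<And>P. P \<in> \<P> \<Longrightarrow> x P \<in> I \<and> x P \<notin> \<Union>(\<P> - {P})" by metis
    have x: "x P \<in> I" "\<And>Q. Q \<in> \<P> \<Longrightarrow> Q \<noteq> P \<Longrightarrow> x P \<notin> Q" if "P \<in> \<P>" for P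
      using x0[OF that] by blast+
    have xP: "x P \<in> P" if "P \<in> \<P>" for P
      using x(1)[OF that] x(2)[OF that] psubset.prems(3) by blast
    obtain P where P: "P \<in> \<P>" using psubset.prems(3) I.zero_closed by blast
    define z where "z = finprod R x (\<P> - {P})"
    have xR: "x \<in> \<P> - {P} \<rightarrow> carrier R" using x(1) I.Icarr by blast
    have fin: "finite (\<P> - {P})" using psubset.hyps by simp
    have zR: "z \<in> carrier R" unfolding z_def using xR by (rule finprod_closed)
    have zP: "z \<notin> P"
      using primeideal_prod_mem[OF psubset.prems(1)[OF P] fin xR] x(2) P unfolding z_def by blast
    have zQ: "z \<in> Q" if "Q \<in> \<P> - {P}" for Q
      unfolding z_def using that xP psubset.prems(1) primeideal.axioms(1)
      by (intro ideal_finprod_mem[OF _ fin xR that]) blast+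
    \<comment> \<open>A single prime is treated apart: the product \<open>z\<close> is then empty,
      equal to one, and may fail to lie in \<open>I\<close>.\<close>
    show ?thesis
    proof (cases "\<P> = {P}")
      case True
      then show ?thesis using psubset.prems(3) by auto
    next
      case False
      then obtain Q where Q: "Q \<in> \<P> - {P}" using P by blast
      have "z \<in> I"
        unfolding z_def using Q x(1) by (intro ideal_finprod_mem[OF psubset.prems(2) fin xR Q]) auto
      then have "x P \<oplus> z \<in> I" using x(1)[OF P] by simp
      then obtain S where S: "S \<in> \<P>" "x P \<oplus> z \<in> S" using psubset.prems(3) by blast
      interpret S: primeideal S R using psubset.prems(1)[OF S(1)] .
      have xPR: "x P \<in> carrier R" using x(1)[OF P] by (rule I.Icarr)
      show ?thesis
      proof (cases "S = P")
        case True
        have "x P \<in> S" using True xP[OF P] by simp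
        then have "(x P \<oplus> z) \<ominus> x P \<in> S"
          unfolding a_minus_def by (rule S.a_closed[OF S(2) S.a_inv_closed])
        moreover have "(x P \<oplus> z) \<ominus> x P = z" using xPR zR by algebra
        ultimately show ?thesis using zP True by simp
      next
        case False
        then have "z \<in> S" using zQ S(1) by blast
        then have "(x P \<oplus> z) \<ominus> z \<in> S"
          unfolding a_minus_def by (rule S.a_closed[OF S(2) S.a_inv_closed])
        moreover have "(x P \<oplus> z) \<ominus> z = x P" using xPR zR by algebra
        ultimately show ?thesis using x(2)[OF P S(1)] False by simp
      qed
    qed
  qed
qed

end

text \<open>By \<open>zd\<close> the annihilators of nonzero classes modulo \<open>L\<close> cover
  \<open>J\<close>. The maximal ones already do, and prime avoidance puts \<open>J\<close> inside a
  single one.\<close>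

lemma exists_socle_element:
  assumes "cring R" and "noetherian_ring R" and L: "ideal L R" and J: "ideal J R"
    and zd: "\<And>y. y \<in> J \<Longrightarrow> \<exists>v \<in> carrier R - L. y \<otimes>\<^bsub>R\<^esub> v \<in> L"
  shows "\<exists>v \<in> carrier R - L. \<forall>y \<in> J. y \<otimes>\<^bsub>R\<^esub> v \<in> L"
proof -
  interpret cring R by fact
  interpret noetherian_ring R by fact
  interpret L: ideal L R by fact
  define ann where "ann v = {y \<in> carrier R. y \<otimes>\<^bsub>R\<^esub> v \<in> L}" for v
  have ann_ideal: "ideal (ann v) R" if "v \<in> carrier R" for v
    unfolding ann_def using ideal_colon[OF L that] .
  \<comment> \<open>the maximal annihilators \<open>ann v\<close>, \<open>v \<in> V\<close>, are prime and, \<open>V\<close> lying in a finitely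
    generated ideal, finite in number\<close>
  define V where "V = {v \<in> carrier R - L. \<forall>w \<in> carrier R - L. ann v \<subseteq> ann w \<longrightarrow> ann w = ann v}"
  have prime: "primeideal (ann v) R" if "v \<in> V" for v
    using that primeideal_of_maximal_colon[OF L, of v] by (simp add: ann_def V_def)
  have below: "\<exists>w \<in> V. ann v \<subseteq> ann w" if v: "v \<in> carrier R - L" for v
  proof -
    have "\<exists>I \<in> ann ` (carrier R - L). ann v \<subseteq> I \<and> (\<forall>K \<in> ann ` (carrier R - L). I \<subseteq> K \<longrightarrow> K = I)"
      using v ann_ideal by (intro exists_maximal_in_ideals) auto
    then obtain I where I: "I \<in> ann ` (carrier R - L)" "ann v \<subseteq> I"
      and max: "\<forall>K \<in> ann ` (carrier R - L). I \<subseteq> K \<longrightarrow> K = I" by (elim bexE conjE)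
    obtain w where w: "w \<in> carrier R - L" "ann v \<subseteq> ann w" "I = ann w" using I by blast
    have "w \<in> V" unfolding V_def using w(1) max by (simp add: w(3))
    then show ?thesis using w(2) by (intro bexI[of _ w])
  qed
  have VR: "V \<subseteq> carrier R" unfolding V_def by blast
  \<comment> \<open>An ideal maximal among those generated by finitely many elements of
    \<open>V\<close> contains all of \<open>V\<close>, since adjoining a further generator cannot
    enlarge it.\<close>
  let ?S = "{genideal R F | F. finite F \<and> F \<subseteq> V}"
  have "\<exists>I \<in> ?S. genideal R {} \<subseteq> I \<and> (\<forall>K \<in> ?S. I \<subseteq> K \<longrightarrow> K = I)"
  proof (rule exists_maximal_in_ideals)
    show "?S \<subseteq> {I. ideal I R}" using VR by (auto intro!: genideal_ideal)
  qed blast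
  then obtain F where F: "finite F" "F \<subseteq> V"
    and Fmax: "\<And>K. finite K \<Longrightarrow> K \<subseteq> V \<Longrightarrow> genideal R F \<subseteq> genideal R K \<Longrightarrow> genideal R K = genideal R F"
    by (smt (verit, best) mem_Collect_eq)
  have FR: "F \<subseteq> carrier R" using F VR by blast
  have VF: "v \<in> genideal R F" if "v \<in> V" for v
  proof -
    have "genideal R F \<subseteq> genideal R (insert v F)"
      using FR VR that by (intro subset_Idl_subset) auto
    then have "genideal R (insert v F) = genideal R F" using Fmax F that by simp
    then show ?thesis using genideal_self[of "insert v F"] FR VR that by auto
  qed
  \<comment> \<open>If \<open>y\<close> kills \<open>F\<close> modulo \<open>L\<close>, it kills the
    ideal generated by \<open>F\<close>, hence \<open>v\<close>. So the prime \<open>ann v\<close>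
    contains the intersection of the \<open>ann w\<close> with \<open>w\<close> in \<open>F\<close>,
    therefore one of them, and maximality of \<open>ann w\<close> makes the two equal.\<close>
  have fin: "ann ` V \<subseteq> ann ` F"
  proof
    fix P assume "P \<in> ann ` V"
    then obtain v where v: "v \<in> V" "P = ann v" by blast
    have "carrier R \<inter> \<Inter>(ann ` F) \<subseteq> P"
    proof
      fix y assume y: "y \<in> carrier R \<inter> \<Inter>(ann ` F)"
      have "F \<subseteq> ann y"
        using y FR by (auto simp: ann_def m_comm subset_iff)
      then have "genideal R F \<subseteq> ann y" using y ann_ideal by (intro genideal_minimal) auto
      then have "v \<in> ann y" using VF[OF v(1)] by blast
      then show "y \<in> P" using y v by (auto simp: ann_def m_comm)
    qed
    then obtain w where w: "w \<in> F" "ann w \<subseteq> P"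
      using primeideal_finite_Inter[OF prime[OF v(1)], of "ann ` F"] v F FR ann_ideal by blast
    have "w \<in> V" using F w(1) by (rule_tac subsetD)
    then have "ann v = ann w" using v w(2) unfolding V_def by simp
    then have "P = ann w" using v by simp
    then show "P \<in> ann ` F" using w by blast
  qed
  have "J \<subseteq> \<Union>(ann ` V)"
  proof
    fix y assume y: "y \<in> J"
    then obtain v where v: "v \<in> carrier R - L" "y \<in> ann v"
      using zd[OF y] ideal.Icarr[OF J y] by (auto simp: ann_def)
    then show "y \<in> \<Union>(ann ` V)" using below[OF v(1)] by blast
  qed
  then obtain v where "v \<in> V" "J \<subseteq> ann v"
    using prime_avoidance[of "ann ` V", OF finite_subset[OF fin] _ J] F prime by blast
  then have "v \<in> carrier R - L" "\<forall>y \<in> J. y \<otimes>\<^bsub>R\<^esub> v \<in> L"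
    by (auto simp: V_def ann_def)
  then show ?thesis by (rule bexI[rotated])
qed

section \<open>Elements outside the maximal ideal of a local ring\<close>

lemma (in noetherian_local_ring) maximalideal: "maximalideal \<mm> R"
  using maximalideal_iff by simp

text \<open>A nonunit generates a proper ideal; an ideal maximal among the proper ones above it is a
  maximal ideal, hence \<open>\<mm>\<close>.\<close>

lemma (in noetherian_local_ring) Units_if_not_mem:
  assumes "x \<in> carrier R" and "x \<notin> \<mm>"
  shows "x \<in> Units R"
proof (rule ccontr)
  assume nu: "x \<notin> Units R"
  let ?S = "{I. ideal I R \<and> I \<noteq> carrier R}"
  have "PIdl x \<noteq> carrier R"
  proof
    assume "PIdl x = carrier R"
    then have "\<one> \<in> PIdl x" by simp
    then obtain y where "y \<in> carrier R" "\<one> = y \<otimes> x" by (auto simp: cgenideal_def)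
    then have "x \<in> Units R"
      using assms(1) m_comm[of x y] unfolding Units_def
      by (intro CollectI conjI bexI[of _ y]) simp_all
    then show False using nu by blast
  qed
  then have "PIdl x \<in> ?S" using cgenideal_ideal[OF assms(1)] by simp
  then have "\<exists>J \<in> ?S. PIdl x \<subseteq> J \<and> (\<forall>K \<in> ?S. J \<subseteq> K \<longrightarrow> K = J)"
    by (rule exists_maximal_in_ideals[rotated]) auto
  then obtain J where J: "J \<in> ?S" "PIdl x \<subseteq> J" and max: "\<forall>K \<in> ?S. J \<subseteq> K \<longrightarrow> K = J"
    by (elim bexE conjE)
  have "maximalideal J R"
  proof (rule maximalidealI)
    fix K assume "ideal K R" "J \<subseteq> K" "K \<subseteq> carrier R"
    then show "K = J \<or> K = carrier R" using max by (cases "K = carrier R") simp_all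
  qed (use J(1) in auto)
  then have "J = \<mm>" using maximalideal_iff by (rule iffD1[rotated])
  then show False using J(2) cgenideal_self[OF assms(1)] assms(2) by blast
qed

subsection \<open>Koszul cohomology and regular sequences\<close>

text \<open>On all functions on words, not only the alternating ones, the Koszul differential is given by
  a recursion without signs or sums. Contraction with a letter \<open>x\<close> is a homotopy from
  multiplication by \<open>x\<close> to zero: this is the recursion equation itself.\<close>

primrec kdiff :: "('a, 'b, 'm) module_scheme \<Rightarrow> 'a list \<Rightarrow> ('a list \<Rightarrow> 'b) \<Rightarrow> 'b" where
  "kdiff M [] c = \<zero>\<^bsub>M\<^esub>"
| "kdiff M (x # l) c = x \<odot>\<^bsub>M\<^esub> c l \<ominus>\<^bsub>M\<^esub> kdiff M l (\<lambda>k. c (x # k))"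

text \<open>Vanishing of the \<open>i\<close>-th cohomology of \<open>M/L\<close>, expressed by cochains with values in \<open>M\<close>.
  A cochain carries values in all degrees; only those on words of length \<open>i\<close> matter. As
  \<open>kdiff M []\<close> is zero, degree \<open>0\<close> needs no special treatment.\<close>

definition kvanish ::
  "'a set \<Rightarrow> ('a, 'b, 'm) module_scheme \<Rightarrow> 'b set \<Rightarrow> nat \<Rightarrow> bool" where
  "kvanish A M L i \<longleftrightarrow>
     (\<forall>c \<in> lists A \<rightarrow> carrier M.
        (\<forall>l \<in> lists A. length l = Suc i \<longrightarrow> kdiff M l c \<in> L) \<longrightarrow>
        (\<exists>e \<in> lists A \<rightarrow> carrier M.
           \<forall>l \<in> lists A. length l = i \<longrightarrow> c l \<ominus>\<^bsub>M\<^esub> kdiff M l e \<in> L))"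

lemma cochain_Cons: "c \<in> lists A \<rightarrow> C \<Longrightarrow> x \<in> A \<Longrightarrow> (\<lambda>k. c (x # k)) \<in> lists A \<rightarrow> C"
  by (simp add: Pi_iff)

section \<open>Subtraction in abelian groups\<close>

context abelian_group
begin

lemma minus_self: "a \<in> carrier G \<Longrightarrow> a \<ominus> a = \<zero>"
  by (simp add: a_minus_def r_neg)

lemma minus_zero_right: "a \<in> carrier G \<Longrightarrow> a \<ominus> \<zero> = a"
  by (simp add: a_minus_def)

lemma minus_minus_cancel:
  "a \<in> carrier G \<Longrightarrow> b \<in> carrier G \<Longrightarrow> a \<ominus> (a \<ominus> b) = b"
  by (simp add: a_minus_def minus_add r_neg2)

lemma minus_diff_swap:
  "a \<in> carrier G \<Longrightarrow> b \<in> carrier G \<Longrightarrow> c \<in> carrier G \<Longrightarrow> (a \<ominus> b) \<ominus> c = (a \<ominus> c) \<ominus> b"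
  by (simp add: a_minus_def a_ac)

lemma minus_diff_distrib:
  "a \<in> carrier G \<Longrightarrow> b \<in> carrier G \<Longrightarrow> c \<in> carrier G \<Longrightarrow> d \<in> carrier G \<Longrightarrow>
     (a \<ominus> b) \<ominus> (c \<ominus> d) = (a \<ominus> c) \<ominus> (b \<ominus> d)"
  by (simp add: a_minus_def minus_add a_ac)

lemma minus_add_minus_cancel:
  "a \<in> carrier G \<Longrightarrow> b \<in> carrier G \<Longrightarrow> c \<in> carrier G \<Longrightarrow> (a \<ominus> b) \<oplus> (b \<ominus> c) = a \<ominus> c"
  by (simp add: a_minus_def a_assoc r_neg1)

lemma eq_of_minus_eq_zero:
  "a \<in> carrier G \<Longrightarrow> b \<in> carrier G \<Longrightarrow> a \<ominus> b = \<zero> \<Longrightarrow> a = b"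
  by (metis minus_minus_cancel minus_zero_right)

end

section \<open>Formal properties of the Koszul differential\<close>

context module
begin

lemma smult_minus_distrib:
  "x \<in> carrier R \<Longrightarrow> a \<in> carrier M \<Longrightarrow> b \<in> carrier M \<Longrightarrow>
     x \<odot>\<^bsub>M\<^esub> (a \<ominus>\<^bsub>M\<^esub> b) = x \<odot>\<^bsub>M\<^esub> a \<ominus>\<^bsub>M\<^esub> x \<odot>\<^bsub>M\<^esub> b"
  by (simp add: a_minus_def smult_r_distr smult_r_minus)

lemma submodule_minus_closed:
  assumes "submodule R L M" and "a \<in> L" and "b \<in> L"
  shows "a \<ominus>\<^bsub>M\<^esub> b \<in> L"
proof -
  interpret L: submodule R L M by fact
  have "\<ominus>\<^bsub>R\<^esub> \<one>\<^bsub>R\<^esub> \<odot>\<^bsub>M\<^esub> b \<in> L" using assms(3) by blast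
  moreover have "\<ominus>\<^bsub>R\<^esub> \<one>\<^bsub>R\<^esub> \<odot>\<^bsub>M\<^esub> b = \<ominus>\<^bsub>M\<^esub> b"
    using assms(3) L.subset by (metis smult_minus_1 subsetD)
  ultimately show ?thesis using assms(2) by (simp add: a_minus_def L.m_closed)
qed

lemma submodule_carrier: "submodule R (carrier M) M"
  by unfold_locales auto

text \<open>The recursion reads \<open>c\<close> only on words one letter shorter than
  \<open>l\<close>, so a condition on \<open>c\<close> in a single degree suffices.\<close>

lemma kdiff_in_submodule:
  assumes "A \<subseteq> carrier R" and "submodule R L M" and "l \<in> lists A"
    and "\<And>k. k \<in> lists A \<Longrightarrow> Suc (length k) = length l \<Longrightarrow> c k \<in> L"
  shows "kdiff M l c \<in> L"
  using assms(3,4)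
proof (induction l arbitrary: c rule: list.induct)
  case Nil
  then show ?case using assms(2) by (simp add: submodule.zero_closed)
next
  case (Cons x l)
  have x: "x \<in> A" "x \<in> carrier R" and l: "l \<in> lists A" using Cons.prems(1) assms(1) by auto
  have "c l \<in> L" using Cons.prems(2)[OF l] by simp
  then have "x \<odot>\<^bsub>M\<^esub> c l \<in> L" using assms(2) x by (simp add: submodule.smult_closed)
  moreover have "kdiff M l (\<lambda>k. c (x # k)) \<in> L"
    using x by (intro Cons.IH l Cons.prems(2)) auto
  ultimately show ?case by (simp add: submodule_minus_closed[OF assms(2)])
qed

lemma kdiff_closed [simp]:
  assumes "A \<subseteq> carrier R" and "c \<in> lists A \<rightarrow> carrier M" and "l \<in> lists A"
  shows "kdiff M l c \<in> carrier M"
  using assms by (intro kdiff_in_submodule[OF _ submodule_carrier]) auto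

lemma kdiff_cong:
  assumes "l \<in> lists A"
    and "\<And>k. k \<in> lists A \<Longrightarrow> Suc (length k) = length l \<Longrightarrow> c k = e k"
  shows "kdiff M l c = kdiff M l e"
  using assms
proof (induction l arbitrary: c e rule: list.induct)
  case (Cons x l)
  have "kdiff M l (\<lambda>k. c (x # k)) = kdiff M l (\<lambda>k. e (x # k))"
    using Cons.prems by (intro Cons.IH) auto
  then show ?case using Cons.prems by auto
qed simp

lemma kdiff_minus:
  assumes "A \<subseteq> carrier R" and "l \<in> lists A"
    and "c \<in> lists A \<rightarrow> carrier M" and "e \<in> lists A \<rightarrow> carrier M"
  shows "kdiff M l (\<lambda>k. c k \<ominus>\<^bsub>M\<^esub> e k) = kdiff M l c \<ominus>\<^bsub>M\<^esub> kdiff M l e"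
  using assms(2-4)
proof (induction l arbitrary: c e rule: list.induct)
  case Nil
  then show ?case by (simp add: M.minus_self)
next
  case (Cons x l)
  have x: "x \<in> A" "x \<in> carrier R" and l: "l \<in> lists A" using Cons.prems(1) assms(1) by auto
  have c: "(\<lambda>k. c (x # k)) \<in> lists A \<rightarrow> carrier M" and e: "(\<lambda>k. e (x # k)) \<in> lists A \<rightarrow> carrier M"
    using Cons.prems x by (simp_all add: cochain_Cons)
  have cl: "c l \<in> carrier M" "e l \<in> carrier M" using Cons.prems l by auto
  show ?case
    using Cons.IH[OF l c e] x cl kdiff_closed[OF assms(1) c l] kdiff_closed[OF assms(1) e l]
    by (simp add: smult_minus_distrib M.minus_diff_distrib)
qed

lemma kdiff_smult:
  assumes "A \<subseteq> carrier R" and "l \<in> lists A" and "c \<in> lists A \<rightarrow> carrier M" and "x \<in> carrier R"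
  shows "kdiff M l (\<lambda>k. x \<odot>\<^bsub>M\<^esub> c k) = x \<odot>\<^bsub>M\<^esub> kdiff M l c"
  using assms(2,3)
proof (induction l arbitrary: c rule: list.induct)
  case Nil
  then show ?case using assms(4) by simp
next
  case (Cons y l)
  have y: "y \<in> A" "y \<in> carrier R" and l: "l \<in> lists A" using Cons.prems(1) assms(1) by auto
  have c: "(\<lambda>k. c (y # k)) \<in> lists A \<rightarrow> carrier M" using Cons.prems y by (simp add: cochain_Cons)
  have cl: "c l \<in> carrier M" using Cons.prems l by auto
  have "y \<odot>\<^bsub>M\<^esub> (x \<odot>\<^bsub>M\<^esub> c l) = x \<odot>\<^bsub>M\<^esub> (y \<odot>\<^bsub>M\<^esub> c l)"
    using y(2) assms(4) cl by (simp flip: smult_assoc1 add: R.m_comm)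
  then show ?case
    using Cons.IH[OF l c] y cl assms(4) kdiff_closed[OF assms(1) c l]
    by (simp add: smult_minus_distrib)
qed

text \<open>Write d for the differential and i_x for contraction with \<open>x\<close>; the
  recursion says i_x d = x - d i_x. Hence i_x d d c = x d c - d (x c - d i_x c) = d d i_x c, which
  vanishes by induction on the word.\<close>

lemma kdiff_kdiff:
  assumes "A \<subseteq> carrier R" and "l \<in> lists A" and "c \<in> lists A \<rightarrow> carrier M"
  shows "kdiff M l (\<lambda>k. kdiff M k c) = \<zero>\<^bsub>M\<^esub>"
  using assms(2,3)
proof (induction l arbitrary: c rule: list.induct)
  case (Cons x l)
  have x: "x \<in> A" "x \<in> carrier R" and l: "l \<in> lists A" using Cons.prems(1) assms(1) by auto
  have c: "(\<lambda>k. c (x # k)) \<in> lists A \<rightarrow> carrier M" using Cons.prems x by (simp add: cochain_Cons)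
  have "kdiff M l (\<lambda>k. kdiff M (x # k) c) =
      kdiff M l (\<lambda>k. x \<odot>\<^bsub>M\<^esub> c k) \<ominus>\<^bsub>M\<^esub> kdiff M l (\<lambda>k. kdiff M k (\<lambda>k. c (x # k)))"
    unfolding kdiff.simps
    using x(2) Cons.prems(2) kdiff_closed[OF assms(1) c] by (intro kdiff_minus[OF assms(1) l]) auto
  also have "\<dots> = x \<odot>\<^bsub>M\<^esub> kdiff M l c"
    using Cons.IH[OF l c] kdiff_smult[OF assms(1) l Cons.prems(2) x(2)] x(2)
      kdiff_closed[OF assms(1) Cons.prems(2) l] by (simp add: M.minus_zero_right)
  \<comment> \<open>The general recursion equation is withheld from the simplifier, so that the
    inner differential stays folded and matches the equations above.\<close>
  finally show ?case
    using x(2) kdiff_closed[OF assms(1) Cons.prems(2) l]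
    by (simp add: M.minus_self del: kdiff.simps(2) add: kdiff.simps(2)[of _ _ _ "\<lambda>k. kdiff M k c"])
qed simp

end

lemma (in mod_hom) kdiff_hom:
  assumes "A \<subseteq> carrier R" and "l \<in> lists A" and "c \<in> lists A \<rightarrow> carrier M"
  shows "kdiff N l (\<lambda>k. f (c k)) = f (kdiff M l c)"
  using assms(2,3)
proof (induction l arbitrary: c rule: list.induct)
  case (Cons x l)
  have x: "x \<in> A" "x \<in> carrier R" and l: "l \<in> lists A" using Cons.prems(1) assms(1) by auto
  have c: "(\<lambda>k. c (x # k)) \<in> lists A \<rightarrow> carrier M" using Cons.prems x by (simp add: cochain_Cons)
  have cl: "c l \<in> carrier M" using Cons.prems l by auto
  show ?case
    using Cons.IH[OF l c] x(2) cl M.kdiff_closed[OF assms(1) c l] by simp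
qed simp


section \<open>Cohomology modulo a nonzerodivisor\<close>

context module
begin

lemma cochain_kdiff:
  "A \<subseteq> carrier R \<Longrightarrow> c \<in> lists A \<rightarrow> carrier M \<Longrightarrow> (\<lambda>l. kdiff M l c) \<in> lists A \<rightarrow> carrier M"
  by (simp add: Pi_iff)

lemma cochain_minus:
  "c \<in> lists A \<rightarrow> carrier M \<Longrightarrow> e \<in> lists A \<rightarrow> carrier M \<Longrightarrow>
     (\<lambda>l. c l \<ominus>\<^bsub>M\<^esub> e l) \<in> lists A \<rightarrow> carrier M"
  by (simp add: Pi_iff)

lemma cochain_smult:
  "c \<in> lists A \<rightarrow> carrier M \<Longrightarrow> x \<in> carrier R \<Longrightarrow> (\<lambda>l. x \<odot>\<^bsub>M\<^esub> c l) \<in> lists A \<rightarrow> carrier M"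
  by (simp add: Pi_iff)

lemma kdiff_minus_in_submodule:
  assumes A: "A \<subseteq> carrier R" and L: "submodule R L M" and l: "l \<in> lists A"
    and c: "c \<in> lists A \<rightarrow> carrier M" and e: "e \<in> lists A \<rightarrow> carrier M"
    and ce: "\<And>k. k \<in> lists A \<Longrightarrow> Suc (length k) = length l \<Longrightarrow> c k \<ominus>\<^bsub>M\<^esub> e k \<in> L"
  shows "kdiff M l c \<ominus>\<^bsub>M\<^esub> kdiff M l e \<in> L"
  unfolding kdiff_minus[OF A l c e, symmetric] using ce by (rule kdiff_in_submodule[OF A L l])

text \<open>With \<open>L' = L + xM\<close>, the next two lemmas extract from the long exact sequence of
  \<open>0 \<rightarrow> M/L \<rightarrow> M/L \<rightarrow> M/L' \<rightarrow> 0\<close> what is needed.\<close>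

lemma kvanish_nonzerodivisor:
  assumes A: "A \<subseteq> carrier R" and L: "submodule R L M" and x: "x \<in> A"
    and nzd: "\<And>v. v \<in> carrier M \<Longrightarrow> x \<odot>\<^bsub>M\<^esub> v \<in> L \<Longrightarrow> v \<in> L"
    and van: "\<And>j. i = Suc j \<Longrightarrow>
      kvanish A M {v \<in> carrier M. \<exists>h \<in> carrier M. v \<ominus>\<^bsub>M\<^esub> x \<odot>\<^bsub>M\<^esub> h \<in> L} j"
  shows "kvanish A M L i"
  unfolding kvanish_def
proof (intro ballI impI)
  interpret L: submodule R L M by fact
  let ?L = "{v \<in> carrier M. \<exists>h \<in> carrier M. v \<ominus>\<^bsub>M\<^esub> x \<odot>\<^bsub>M\<^esub> h \<in> L}"
  fix c assume c: "c \<in> lists A \<rightarrow> carrier M"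
    and cyc: "\<forall>l\<in>lists A. length l = Suc i \<longrightarrow> kdiff M l c \<in> L"
  have xR: "x \<in> carrier R" using x A by blast
  \<comment> \<open>This is the contraction of the cocycle \<open>c\<close> with \<open>x\<close>.
    Its differential is x c modulo \<open>L\<close>, so \<open>e\<close> is a cocycle modulo L +
    xM.\<close>
  define e where "e = (\<lambda>k. c (x # k))"
  have e: "e \<in> lists A \<rightarrow> carrier M" unfolding e_def using c x by (simp add: cochain_Cons)
  have xc: "x \<odot>\<^bsub>M\<^esub> c l \<ominus>\<^bsub>M\<^esub> kdiff M l e \<in> L" if "l \<in> lists A" "length l = i" for l
    using cyc[rule_format, of "x # l"] that x by (simp add: e_def)
  show "\<exists>e\<in>lists A \<rightarrow> carrier M. \<forall>l\<in>lists A. length l = i \<longrightarrow> c l \<ominus>\<^bsub>M\<^esub> kdiff M l e \<in> L"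
  proof (cases i)
    case 0
    \<comment> \<open>Coboundaries in degree 0 are zero, so \<open>c []\<close> itself has to lie in
      \<open>L\<close>; \<open>c\<close> then serves as an arbitrary witness.\<close>
    have "c [] \<in> carrier M" using c by (auto simp: Pi_iff)
    moreover have "x \<odot>\<^bsub>M\<^esub> c [] \<in> L"
      using xc[of "[]"] 0 xR calculation by (simp add: M.minus_zero_right)
    ultimately have "c [] \<ominus>\<^bsub>M\<^esub> kdiff M [] c \<in> L" using nzd by (simp add: M.minus_zero_right)
    then show ?thesis using 0 by (intro bexI[OF _ c]) simp
  next
    case (Suc j)
    have "kdiff M l e \<in> ?L" if l: "l \<in> lists A" "length l = Suc j" for l
    proof -
      have m: "c l \<in> carrier M" "kdiff M l e \<in> carrier M"
        using c l(1) kdiff_closed[OF A e l(1)] by (auto simp: Pi_iff)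
      have "\<ominus>\<^bsub>R\<^esub> \<one>\<^bsub>R\<^esub> \<odot>\<^bsub>M\<^esub> (x \<odot>\<^bsub>M\<^esub> c l \<ominus>\<^bsub>M\<^esub> kdiff M l e) \<in> L"
        using xc[OF l(1)] l(2) Suc by blast
      then have "kdiff M l e \<ominus>\<^bsub>M\<^esub> x \<odot>\<^bsub>M\<^esub> c l \<in> L"
        using m xR by (simp add: a_minus_def smult_r_distr smult_minus_1 M.a_comm)
      then show ?thesis using m by blast
    qed
    then obtain g where g: "g \<in> lists A \<rightarrow> carrier M"
      and eg: "\<And>l. l \<in> lists A \<Longrightarrow> length l = j \<Longrightarrow> e l \<ominus>\<^bsub>M\<^esub> kdiff M l g \<in> ?L"
      using van[OF Suc] e unfolding kvanish_def by meson
    \<comment> \<open>Since e - dg takes values in L + xM, there are factors \<open>h l\<close> with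
      e - dg - xh in \<open>L\<close>. On words of other lengths \<open>P\<close> asks only for an
      element of \<open>M\<close>, so that \<open>h\<close> is a cochain.\<close>
    define P where "P l v \<longleftrightarrow> v \<in> carrier M \<and>
      (length l = j \<longrightarrow> (e l \<ominus>\<^bsub>M\<^esub> kdiff M l g) \<ominus>\<^bsub>M\<^esub> x \<odot>\<^bsub>M\<^esub> v \<in> L)" for l v
    have "\<forall>l\<in>lists A. \<exists>v. P l v"
      using eg unfolding P_def by blast
    then obtain h where h0: "\<And>l. l \<in> lists A \<Longrightarrow> P l (h l)" by metis
    have h: "h \<in> lists A \<rightarrow> carrier M" using h0 by (simp add: P_def Pi_iff)
    note dg = cochain_kdiff[OF A g]
    have "c l \<ominus>\<^bsub>M\<^esub> kdiff M l h \<in> L" if l: "l \<in> lists A" "length l = i" for l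
    proof (rule nzd)
      note [simp] = kdiff_closed[OF A _ l(1)]
      have cl: "c l \<in> carrier M" using c l by auto
      then show "c l \<ominus>\<^bsub>M\<^esub> kdiff M l h \<in> carrier M" using h by simp
      \<comment> \<open>Applying d to e - dg - xh removes dg and leaves de - x dh in
        \<open>L\<close>. Adding xc - de gives x (c - dh) in \<open>L\<close>, and
        \<open>nzd\<close> cancels \<open>x\<close>.\<close>
      have "kdiff M l (\<lambda>l. e l \<ominus>\<^bsub>M\<^esub> kdiff M l g) \<ominus>\<^bsub>M\<^esub> kdiff M l (\<lambda>l. x \<odot>\<^bsub>M\<^esub> h l) \<in> L"
        using h0 Suc l
        by (intro kdiff_minus_in_submodule[OF A L l(1)] cochain_minus cochain_smult dg e h xR)
          (auto simp: P_def)
      then have "kdiff M l e \<ominus>\<^bsub>M\<^esub> x \<odot>\<^bsub>M\<^esub> kdiff M l h \<in> L"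
        using e h xR kdiff_minus[OF A l(1) e dg] kdiff_kdiff[OF A l(1) g]
        by (simp add: kdiff_smult[OF A l(1) h xR] M.minus_zero_right)
      from L.m_closed[OF xc[OF l] this]
      show "x \<odot>\<^bsub>M\<^esub> (c l \<ominus>\<^bsub>M\<^esub> kdiff M l h) \<in> L"
        using e h xR cl by (simp add: smult_minus_distrib M.minus_add_minus_cancel)
    qed
    then show ?thesis using h by blast
  qed
qed

lemma kvanish_quotient:
  assumes A: "A \<subseteq> carrier R" and L: "submodule R L M" and xR: "x \<in> carrier R"
    and nzd: "\<And>v. v \<in> carrier M \<Longrightarrow> x \<odot>\<^bsub>M\<^esub> v \<in> L \<Longrightarrow> v \<in> L"
    and van: "kvanish A M L i" "kvanish A M L (Suc i)"
  shows "kvanish A M {v \<in> carrier M. \<exists>h \<in> carrier M. v \<ominus>\<^bsub>M\<^esub> x \<odot>\<^bsub>M\<^esub> h \<in> L} i"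
  unfolding kvanish_def
proof (intro ballI impI)
  interpret L: submodule R L M by fact
  let ?L = "{v \<in> carrier M. \<exists>h \<in> carrier M. v \<ominus>\<^bsub>M\<^esub> x \<odot>\<^bsub>M\<^esub> h \<in> L}"
  fix c assume c: "c \<in> lists A \<rightarrow> carrier M"
    and cyc: "\<forall>l\<in>lists A. length l = Suc i \<longrightarrow> kdiff M l c \<in> ?L"
  \<comment> \<open>The connecting homomorphism: \<open>e\<close> will satisfy dc = xe modulo
    \<open>L\<close> on words of length \<open>Suc i\<close>.\<close>
  define P where "P l v \<longleftrightarrow> v \<in> carrier M \<and>
    (length l = Suc i \<longrightarrow> kdiff M l c \<ominus>\<^bsub>M\<^esub> x \<odot>\<^bsub>M\<^esub> v \<in> L)" for l v
  have "\<forall>l\<in>lists A. \<exists>v. P l v" using cyc unfolding P_def by blast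
  then obtain e where e0: "\<And>l. l \<in> lists A \<Longrightarrow> P l (e l)" by metis
  have e: "e \<in> lists A \<rightarrow> carrier M" using e0 by (simp add: P_def Pi_iff)
  have ce: "kdiff M l c \<ominus>\<^bsub>M\<^esub> x \<odot>\<^bsub>M\<^esub> e l \<in> L" if "l \<in> lists A" "length l = Suc i" for l
    using e0[OF that(1)] that(2) by (simp add: P_def)
  note dc = cochain_kdiff[OF A c]
  \<comment> \<open>Since ddc = 0, the differential of dc - xe is -x de. So x de lies in
    \<open>L\<close>, and \<open>nzd\<close> makes \<open>e\<close> a cocycle modulo
    \<open>L\<close>.\<close>
  have "kdiff M l e \<in> L" if l: "l \<in> lists A" "length l = Suc (Suc i)" for l
  proof (rule nzd)
    note [simp] = kdiff_closed[OF A _ l(1)]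
    show "kdiff M l e \<in> carrier M" using e by simp
    have "kdiff M l (\<lambda>l. kdiff M l c) \<ominus>\<^bsub>M\<^esub> kdiff M l (\<lambda>l. x \<odot>\<^bsub>M\<^esub> e l) \<in> L"
      using l ce by (intro kdiff_minus_in_submodule[OF A L l(1)] cochain_smult dc e xR) auto
    then have "\<zero>\<^bsub>M\<^esub> \<ominus>\<^bsub>M\<^esub> x \<odot>\<^bsub>M\<^esub> kdiff M l e \<in> L"
      by (simp add: kdiff_smult[OF A l(1) e xR] kdiff_kdiff[OF A l(1) c])
    from submodule_minus_closed[OF L L.zero_closed this]
    show "x \<odot>\<^bsub>M\<^esub> kdiff M l e \<in> L" using e xR by (simp add: M.minus_minus_cancel)
  qed
  then obtain g where g: "g \<in> lists A \<rightarrow> carrier M"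
    and eg: "\<And>l. l \<in> lists A \<Longrightarrow> length l = Suc i \<Longrightarrow> e l \<ominus>\<^bsub>M\<^esub> kdiff M l g \<in> L"
    using van(2) e unfolding kvanish_def by meson
  note xg = cochain_smult[OF g xR]
  note cxg = cochain_minus[OF c xg]
  \<comment> \<open>With e = dg modulo \<open>L\<close>, dc - x dg = (dc - xe) + x (e - dg) lies in
    \<open>L\<close>. Thus c - xg is a cocycle modulo \<open>L\<close>, and writing it as dh modulo
    \<open>L\<close> gives c = dh modulo L + xM.\<close>
  have "kdiff M l (\<lambda>l. c l \<ominus>\<^bsub>M\<^esub> x \<odot>\<^bsub>M\<^esub> g l) \<in> L" if l: "l \<in> lists A" "length l = Suc i" for l
  proof -
    note [simp] = kdiff_closed[OF A _ l(1)]
    have el: "e l \<in> carrier M" using e l by auto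
    have "x \<odot>\<^bsub>M\<^esub> (e l \<ominus>\<^bsub>M\<^esub> kdiff M l g) \<in> L" using eg[OF l] xR by blast
    from L.m_closed[OF ce[OF l] this]
    show ?thesis
      using el g c xR by (simp add: kdiff_minus[OF A l(1) c xg] kdiff_smult[OF A l(1) g xR]
          smult_minus_distrib M.minus_add_minus_cancel)
  qed
  then obtain h where h: "h \<in> lists A \<rightarrow> carrier M"
    and ch: "\<And>l. l \<in> lists A \<Longrightarrow> length l = i \<Longrightarrow> (c l \<ominus>\<^bsub>M\<^esub> x \<odot>\<^bsub>M\<^esub> g l) \<ominus>\<^bsub>M\<^esub> kdiff M l h \<in> L"
    using van(1) cxg unfolding kvanish_def by (smt (verit))
  have "c l \<ominus>\<^bsub>M\<^esub> kdiff M l h \<in> ?L" if l: "l \<in> lists A" "length l = i" for l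
  proof -
    have m: "c l \<in> carrier M" "g l \<in> carrier M" "kdiff M l h \<in> carrier M"
      using c g l kdiff_closed[OF A h l(1)] by (auto simp: Pi_iff)
    then have "(c l \<ominus>\<^bsub>M\<^esub> kdiff M l h) \<ominus>\<^bsub>M\<^esub> x \<odot>\<^bsub>M\<^esub> g l \<in> L"
      using ch[OF l] xR by (simp add: M.minus_diff_swap)
    then show ?thesis using m by blast
  qed
  then show "\<exists>e\<in>lists A \<rightarrow> carrier M. \<forall>l\<in>lists A. length l = i \<longrightarrow> c l \<ominus>\<^bsub>M\<^esub> kdiff M l e \<in> ?L"
    using h by blast
qed

section \<open>Submodules generated by sequences; cohomology along a regular sequence\<close>

lemma list_smult_submodule:
  assumes "set xs \<subseteq> carrier R" shows "submodule R (list_smult R xs M) M"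
  unfolding list_smult_def using assms by (intro span_is_submodule) auto

lemma list_smult_Nil: "list_smult R [] M = {\<zero>\<^bsub>M\<^esub>}"
  by (auto simp: list_smult_def span_def lincomb_def)

lemma submodule_extend:
  assumes L: "submodule R L M" and x: "x \<in> carrier R"
  shows "submodule R {v \<in> carrier M. \<exists>h \<in> carrier M. v \<ominus>\<^bsub>M\<^esub> x \<odot>\<^bsub>M\<^esub> h \<in> L} M" (is "submodule R ?L M")
proof
  interpret L: submodule R L M by fact
  show "?L \<subseteq> carrier M" by blast
  show "\<zero>\<^bsub>M\<^esub> \<in> ?L" using x by (auto intro!: bexI[of _ "\<zero>\<^bsub>M\<^esub>"] simp: M.minus_zero_right)
  fix v w assume "v \<in> ?L" "w \<in> ?L"
  then obtain h k where h: "h \<in> carrier M" "v \<ominus>\<^bsub>M\<^esub> x \<odot>\<^bsub>M\<^esub> h \<in> L" "k \<in> carrier M" "w \<ominus>\<^bsub>M\<^esub> x \<odot>\<^bsub>M\<^esub> k \<in> L"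
    and vw: "v \<in> carrier M" "w \<in> carrier M" by blast
  have "(v \<oplus>\<^bsub>M\<^esub> w) \<ominus>\<^bsub>M\<^esub> x \<odot>\<^bsub>M\<^esub> (h \<oplus>\<^bsub>M\<^esub> k) = (v \<ominus>\<^bsub>M\<^esub> x \<odot>\<^bsub>M\<^esub> h) \<oplus>\<^bsub>M\<^esub> (w \<ominus>\<^bsub>M\<^esub> x \<odot>\<^bsub>M\<^esub> k)"
    using vw h x by (simp add: a_minus_def smult_r_distr M.minus_add M.a_ac)
  then have "(v \<oplus>\<^bsub>M\<^esub> w) \<ominus>\<^bsub>M\<^esub> x \<odot>\<^bsub>M\<^esub> (h \<oplus>\<^bsub>M\<^esub> k) \<in> L" using h by simp
  then show "v \<oplus>\<^bsub>M\<^esub> w \<in> ?L" using vw h by blast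
next
  interpret L: submodule R L M by fact
  fix c v assume c: "c \<in> carrier R" and "v \<in> ?L"
  then obtain h where h: "h \<in> carrier M" "v \<ominus>\<^bsub>M\<^esub> x \<odot>\<^bsub>M\<^esub> h \<in> L" and v: "v \<in> carrier M" by blast
  have "c \<odot>\<^bsub>M\<^esub> (x \<odot>\<^bsub>M\<^esub> h) = x \<odot>\<^bsub>M\<^esub> (c \<odot>\<^bsub>M\<^esub> h)"
    using x c h by (simp flip: smult_assoc1 add: R.m_comm)
  then have "c \<odot>\<^bsub>M\<^esub> v \<ominus>\<^bsub>M\<^esub> x \<odot>\<^bsub>M\<^esub> (c \<odot>\<^bsub>M\<^esub> h) \<in> L"
    using L.smult_closed[OF c h(2)] c v h x by (simp add: smult_minus_distrib)
  then show "c \<odot>\<^bsub>M\<^esub> v \<in> ?L" using c v h by blast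
qed

text \<open>Brings the submodule of an extended sequence into the form L + xM used by
  \<open>kvanish_nonzerodivisor\<close> and \<open>kvanish_quotient\<close>.\<close>

lemma list_smult_snoc:
  assumes xs: "set xs \<subseteq> carrier R" and x: "x \<in> carrier R"
  shows "list_smult R (xs @ [x]) M =
    {v \<in> carrier M. \<exists>h \<in> carrier M. v \<ominus>\<^bsub>M\<^esub> x \<odot>\<^bsub>M\<^esub> h \<in> list_smult R xs M}" (is "?l = ?r")
proof
  let ?S = "\<lambda>xs. {x \<odot>\<^bsub>M\<^esub> v | x v. x \<in> set xs \<and> v \<in> carrier M}"
  have S: "?S ys \<subseteq> list_smult R ys M" if "set ys \<subseteq> carrier R" for ys
    unfolding list_smult_def using that by (intro in_own_span) auto
  interpret L: submodule R "list_smult R xs M" M using list_smult_submodule[OF xs] .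
  interpret L': submodule R ?l M using xs x by (intro list_smult_submodule) auto
  have sub: "list_smult R xs M \<subseteq> ?r"
  proof
    fix v assume v: "v \<in> list_smult R xs M"
    then show "v \<in> ?r" using x L.subset
      by (auto intro!: bexI[of _ "\<zero>\<^bsub>M\<^esub>"] simp: M.minus_zero_right subset_iff)
  qed
  have x': "x \<odot>\<^bsub>M\<^esub> v \<in> ?r" if "v \<in> carrier M" for v
    using that x L.zero_closed by (auto intro!: bexI[of _ v] simp: M.minus_self)
  have "?S (xs @ [x]) \<subseteq> ?r"
  proof
    fix v assume "v \<in> ?S (xs @ [x])"
    then obtain y u where v: "v = y \<odot>\<^bsub>M\<^esub> u" and y: "y \<in> set (xs @ [x])" and u: "u \<in> carrier M"
      by (elim CollectE exE conjE)
    show "v \<in> ?r"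
    proof (cases "y = x")
      case True
      then show ?thesis using x'[OF u] v by (simp only:)
    next
      case False
      then have "v \<in> ?S xs" using v y u by auto
      then show ?thesis by (rule subsetD[OF sub subsetD[OF S[OF xs]]])
    qed
  qed
  then show "?l \<subseteq> ?r"
    unfolding list_smult_def[of R "xs @ [x]"]
    by (intro span_is_subset submodule_extend[OF L.submodule_axioms x])
  have "list_smult R xs M \<subseteq> ?l"
    unfolding list_smult_def[of R xs]
    using S[of "xs @ [x]"] xs x by (intro span_is_subset[OF _ L'.submodule_axioms]) auto
  moreover have "x \<odot>\<^bsub>M\<^esub> h \<in> ?l" if "h \<in> carrier M" for h
    using S[of "xs @ [x]"] xs x that by auto
  ultimately show "?r \<subseteq> ?l"
  proof (intro subsetI)
    fix v assume "v \<in> ?r"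
    then obtain h where h: "v \<in> carrier M" "h \<in> carrier M" "v \<ominus>\<^bsub>M\<^esub> x \<odot>\<^bsub>M\<^esub> h \<in> list_smult R xs M" by blast
    then have "(v \<ominus>\<^bsub>M\<^esub> x \<odot>\<^bsub>M\<^esub> h) \<oplus>\<^bsub>M\<^esub> x \<odot>\<^bsub>M\<^esub> h \<in> ?l"
      using \<open>list_smult R xs M \<subseteq> ?l\<close> S[of "xs @ [x]"] xs x by (intro L'.m_closed) auto
    then show "v \<in> ?l" using h x by (simp add: a_minus_def M.a_assoc M.l_neg)
  qed
qed

text \<open>Descending induction on \<open>j\<close>: each element of the sequence that is no longer
  divided out gains one degree of vanishing by \<open>kvanish_nonzerodivisor\<close>. For
  \<open>j = length xs\<close> no degree is claimed.\<close>

lemma kvanish_regular_sequence: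
  assumes A: "A \<subseteq> carrier R" and xs: "set xs \<subseteq> A" and reg: "regular_sequence R M xs"
    and j: "j \<le> length xs" and i: "i + j < length xs"
  shows "kvanish A M (list_smult R (take j xs) M) i"
  using j i
proof (induction j arbitrary: i rule: inc_induct)
  case base
  then show ?case by simp
next
  case (step n)
  have tk: "set (take n xs) \<subseteq> carrier R" using xs A set_take_subset by fast
  have xn: "xs ! n \<in> A" using xs step by auto
  have eq: "list_smult R (take (Suc n) xs) M = {v \<in> carrier M. \<exists>h \<in> carrier M.
      v \<ominus>\<^bsub>M\<^esub> (xs ! n) \<odot>\<^bsub>M\<^esub> h \<in> list_smult R (take n xs) M}"
    using list_smult_snoc[OF tk, of "xs ! n"] xn A step by (auto simp: take_Suc_conv_app_nth)
  show ?case
  proof (rule kvanish_nonzerodivisor[OF A list_smult_submodule[OF tk] xn])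
    show "v \<in> list_smult R (take n xs) M"
      if "v \<in> carrier M" "xs ! n \<odot>\<^bsub>M\<^esub> v \<in> list_smult R (take n xs) M" for v
      using reg that step by (simp add: regular_sequence_def)
    show "kvanish A M {v \<in> carrier M. \<exists>h\<in>carrier M.
        v \<ominus>\<^bsub>M\<^esub> xs ! n \<odot>\<^bsub>M\<^esub> h \<in> list_smult R (take n xs) M} k" if "i = Suc k" for k
      unfolding eq[symmetric] using step that by (intro step.IH) auto
  qed
qed

text \<open>Let r be the length of \<open>xs\<close>. Modulo all of \<open>xs\<close>, the class of
  \<open>s\<close> is nonzero in degree 0. Modulo only the first n elements, vanishing in degree r -
  n, with the vanishing in degree r - n - 1 from \<open>kvanish_regular_sequence\<close>, would by
  \<open>kvanish_quotient\<close> contradict the induction hypothesis.\<close>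

lemma not_kvanish_regular_sequence:
  assumes A: "A \<subseteq> carrier R" and xs: "set xs \<subseteq> A" and reg: "regular_sequence R M xs"
    and s: "s \<in> carrier M" "s \<notin> list_smult R xs M"
      "\<And>a. a \<in> A \<Longrightarrow> a \<odot>\<^bsub>M\<^esub> s \<in> list_smult R xs M"
    and j: "j \<le> length xs"
  shows "\<not> kvanish A M (list_smult R (take j xs) M) (length xs - j)"
  using j
proof (induction j rule: inc_induct)
  case base
  show ?case
  proof
    assume "kvanish A M (list_smult R (take (length xs) xs) M) (length xs - length xs)"
    \<comment> \<open>Vanishing is tested on the constant cochain \<open>s\<close>. On a one-letter
      word its differential is the letter times \<open>s\<close>, because the differential on the
      empty word is zero.\<close>
    then have "(\<forall>l \<in> lists A. length l = Suc 0 \<longrightarrow> kdiff M l (\<lambda>_. s) \<in> list_smult R xs M) \<longrightarrow>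
        (\<exists>e \<in> lists A \<rightarrow> carrier M. \<forall>l \<in> lists A. length l = 0 \<longrightarrow>
          s \<ominus>\<^bsub>M\<^esub> kdiff M l e \<in> list_smult R xs M)"
      using s(1) unfolding kvanish_def diff_self_eq_0 take_all[OF order_refl]
      by (elim bspec) simp
    moreover have "kdiff M l (\<lambda>_. s) \<in> list_smult R xs M" if "l \<in> lists A" "length l = Suc 0" for l
      using that s A by (auto simp: length_Suc_conv M.minus_zero_right subset_iff)
    ultimately show False using s by (auto simp: M.minus_zero_right)
  qed
next
  case (step n)
  have tk: "set (take n xs) \<subseteq> carrier R" using xs A set_take_subset by fast
  have xn: "xs ! n \<in> carrier R" using xs step A by (meson nth_mem subsetD)
  have eq: "list_smult R (take (Suc n) xs) M = {v \<in> carrier M. \<exists>h \<in> carrier M.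
      v \<ominus>\<^bsub>M\<^esub> (xs ! n) \<odot>\<^bsub>M\<^esub> h \<in> list_smult R (take n xs) M}"
    using list_smult_snoc[OF tk, of "xs ! n"] xn step by (auto simp: take_Suc_conv_app_nth)
  have nzd: "v \<in> list_smult R (take n xs) M"
    if "v \<in> carrier M" "xs ! n \<odot>\<^bsub>M\<^esub> v \<in> list_smult R (take n xs) M" for v
    using reg that step by (simp add: regular_sequence_def)
  have "kvanish A M (list_smult R (take n xs) M) (length xs - Suc n)"
    using step by (intro kvanish_regular_sequence[OF A xs reg]) auto
  moreover have "Suc (length xs - Suc n) = length xs - n" using step by simp
  ultimately show ?case
    using step.IH kvanish_quotient[OF A list_smult_submodule[OF tk] xn nzd] eq by metis
qed

lemma kvanish_zero_depth:
  assumes "\<mm> \<subseteq> carrier R" and "enat r \<le> depth R \<mm> M" and "i < r"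
  shows "kvanish \<mm> M {\<zero>\<^bsub>M\<^esub>} i"
proof (cases "carrier M = {\<zero>\<^bsub>M\<^esub>}")
  case True
  \<comment> \<open>Here the depth is infinite by convention, and all differences vanish because
    zero is the only element.\<close>
  have "c l \<ominus>\<^bsub>M\<^esub> kdiff M l c \<in> {\<zero>\<^bsub>M\<^esub>}" if "c \<in> lists \<mm> \<rightarrow> carrier M" "l \<in> lists \<mm>" for c l
    using kdiff_closed[OF assms(1) that] that True by (auto simp: Pi_iff M.minus_self)
  then show ?thesis unfolding kvanish_def by blast
next
  case False
  \<comment> \<open>A number strictly below the supremum is below the length of some regular
    sequence, whether or not the supremum is attained.\<close>
  then have "enat i < Sup {enat (length xs) | xs. set xs \<subseteq> \<mm> \<and> regular_sequence R M xs}"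
    using assms(2,3) by (simp add: depth_def) (meson enat_ord_simps(2) less_le_trans)
  then obtain xs where "set xs \<subseteq> \<mm>" "regular_sequence R M xs" "i < length xs"
    by (auto simp: less_Sup_iff)
  then show ?thesis
    using kvanish_regular_sequence[OF assms(1), of xs 0 i] by (simp add: list_smult_Nil)
qed

end

subsection \<open>The ring as a module\<close>

lemma ring_module_simps [simp]:
  "carrier (ring_module R) = carrier R" "zero (ring_module R) = zero R"
  "add (ring_module R) = add R" "smult (ring_module R) = mult R"
  by (simp_all add: ring_module_def)

lemma module_power_simps [simp]:
  "carrier (module_power M n) = {..<n} \<rightarrow>\<^sub>E carrier M"
  "zero (module_power M n) = (\<lambda>i\<in>{..<n}. \<zero>\<^bsub>M\<^esub>)"
  "add (module_power M n) = (\<lambda>v w. \<lambda>i\<in>{..<n}. v i \<oplus>\<^bsub>M\<^esub> w i)"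
  "smult (module_power M n) = (\<lambda>a v. \<lambda>i\<in>{..<n}. a \<odot>\<^bsub>M\<^esub> v i)"
  by (simp_all add: module_power_def)

lemma module_power_proj:
  assumes "module R M" and "i < n"
  shows "mod_hom R (module_power M n) M (\<lambda>v. v i)"
  using assms by (intro mod_hom.intro mod_hom_axioms.intro module_power_is_module)
    (auto simp: module_hom_def)

lemma mod_homI: "module R M \<Longrightarrow> module R N \<Longrightarrow> f \<in> module_hom R M N \<Longrightarrow> mod_hom R M N f"
  by (intro mod_hom.intro mod_hom_axioms.intro)

lemma (in module) list_smult_append_mono:
  assumes "set xs \<subseteq> carrier R" and "set ys \<subseteq> carrier R"
  shows "list_smult R xs M \<subseteq> list_smult R (xs @ ys) M"
proof -
  let ?S = "\<lambda>xs. {x \<odot>\<^bsub>M\<^esub> v | x v. x \<in> set xs \<and> v \<in> carrier M}"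
  have "?S xs \<subseteq> ?S (xs @ ys)" by auto
  also have "?S (xs @ ys) \<subseteq> list_smult R (xs @ ys) M"
    unfolding list_smult_def using assms by (intro in_own_span) auto
  finally show ?thesis
    unfolding list_smult_def[of R xs] using assms
    by (intro span_is_subset list_smult_submodule) auto
qed

lemma (in module) smult_mem_list_smult:
  assumes "set xs \<subseteq> carrier R" and "x \<in> set xs" and "v \<in> carrier M"
  shows "x \<odot>\<^bsub>M\<^esub> v \<in> list_smult R xs M"
proof -
  have "x \<odot>\<^bsub>M\<^esub> v \<in> {x \<odot>\<^bsub>M\<^esub> v | x v. x \<in> set xs \<and> v \<in> carrier M}" using assms by blast
  moreover have "{x \<odot>\<^bsub>M\<^esub> v | x v. x \<in> set xs \<and> v \<in> carrier M} \<subseteq> list_smult R xs M"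
    unfolding list_smult_def using assms(1) by (intro in_own_span) auto
  ultimately show ?thesis by blast
qed

lemma (in cring) submodule_ring_module_iff:
  "submodule R L (ring_module R) \<longleftrightarrow> ideal L R"
proof
  assume "submodule R L (ring_module R)"
  then interpret L: submodule R L "ring_module R" .
  have sub: "L \<subseteq> carrier R" using L.subset by simp
  have closed: "x \<otimes> a \<in> L" if "a \<in> L" "x \<in> carrier R" for a x
    using L.smult_closed[OF that(2,1)] by simp
  have neg: "\<ominus> a \<in> L" if a: "a \<in> L" for a
  proof -
    have "a \<in> carrier R" using a sub by (rule_tac subsetD)
    then have "\<ominus> a = \<ominus> \<one> \<otimes> a" by (simp add: l_minus)
    then show ?thesis using closed[OF a, of "\<ominus> \<one>"] by simp
  qed
  have closed': "a \<otimes> x \<in> L" if "a \<in> L" "x \<in> carrier R" for a x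
    using closed[OF that] m_comm[of a x] that(2) subsetD[OF sub that(1)] by simp
  show "ideal L R"
  proof (intro idealI ring_axioms subgroup.intro)
    show "a \<otimes>\<^bsub>add_monoid R\<^esub> b \<in> L" if "a \<in> L" "b \<in> L" for a b
      using L.m_closed[OF that] by simp
    show "\<one>\<^bsub>add_monoid R\<^esub> \<in> L" using L.zero_closed by simp
    show "inv\<^bsub>add_monoid R\<^esub> a \<in> L" if "a \<in> L" for a
      using neg[OF that] by (simp add: a_inv_def)
  qed (use sub closed closed' in simp_all)
next
  assume "ideal L R"
  then interpret L: ideal L R .
  show "submodule R L (ring_module R)"
    by (intro submodule.intro ring_module_is_module is_cring)
      (auto simp: L.I_l_closed L.Icarr)
qed

section \<open>Maximal regular sequences in the local ring\<close>

context noetherian_local_ring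
begin

lemma maximal_subset: "\<mm> \<subseteq> carrier R"
  by (rule additive_subgroup.a_subset[OF ideal.axioms(1)[OF maximalideal.axioms(1)[OF maximalideal]]])

text \<open>Maximality is imposed on the ideal generated by \<open>xs\<close> rather than on the
  length, so the Noetherian condition supplies it. Modulo this ideal every element of
  \<open>\<mm>\<close> is a zero divisor, and \<open>exists_socle_element\<close> applies.\<close>

lemma exists_regular_sequence_socle:
  obtains xs s where "set xs \<subseteq> \<mm>" "regular_sequence R (ring_module R) xs"
    "s \<in> carrier R" "s \<notin> list_smult R xs (ring_module R)"
    "\<forall>y \<in> \<mm>. y \<otimes> s \<in> list_smult R xs (ring_module R)"
proof -
  interpret Q: module R "ring_module R" by (rule ring_module_is_module[OF is_cring])
  interpret \<mm>: maximalideal \<mm> R by (rule maximalideal)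
  let ?L = "\<lambda>xs. list_smult R xs (ring_module R)"
  have L: "ideal (?L xs) R" if "set xs \<subseteq> \<mm>" for xs
    using Q.list_smult_submodule[OF subset_trans[OF that maximal_subset]]
    by (simp add: submodule_ring_module_iff)
  have L\<mm>: "?L xs \<subseteq> \<mm>" if xs: "set xs \<subseteq> \<mm>" for xs
    unfolding list_smult_def
  proof (rule Q.span_is_subset)
    show "submodule R \<mm> (ring_module R)"
      using \<mm>.ideal_axioms by (simp add: submodule_ring_module_iff)
    have "x \<otimes> v \<in> \<mm>" if "x \<in> set xs" "v \<in> carrier R" for x v
      by (rule \<mm>.I_r_closed[OF subsetD[OF xs that(1)] that(2)])
    then show "{x \<odot>\<^bsub>ring_module R\<^esub> v | x v. x \<in> set xs \<and> v \<in> carrier (ring_module R)} \<subseteq> \<mm>"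
      by auto
  qed
  have one: "\<one> \<notin> \<mm>" using \<mm>.I_notcarr \<mm>.one_imp_carrier by auto
  have one_L: "\<one> \<notin> ?L xs" if "set xs \<subseteq> \<mm>" for xs using L\<mm>[OF that] one by blast
  have ne: "?L xs \<noteq> carrier R" if "set xs \<subseteq> \<mm>" for xs using one_L[OF that] one_closed by metis
  let ?S = "{?L xs | xs. set xs \<subseteq> \<mm> \<and> regular_sequence R (ring_module R) xs}"
  have "regular_sequence R (ring_module R) []" using ne[of "[]"] by (simp add: regular_sequence_def)
  then have "?L [] \<in> ?S" by (intro CollectI exI[of _ "[]"]) simp
  then have "\<exists>J \<in> ?S. ?L [] \<subseteq> J \<and> (\<forall>K \<in> ?S. J \<subseteq> K \<longrightarrow> K = J)"
    using L by (intro exists_maximal_in_ideals) auto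
  then obtain xs where xs: "set xs \<subseteq> \<mm>" and reg: "regular_sequence R (ring_module R) xs"
    and max: "\<forall>K \<in> ?S. ?L xs \<subseteq> K \<longrightarrow> K = ?L xs"
    by (elim bexE conjE CollectE exE) simp
  have "\<exists>v \<in> carrier R - ?L xs. y \<otimes> v \<in> ?L xs" if y: "y \<in> \<mm>" for y
  proof (rule ccontr)
    assume "\<not> ?thesis"
    then have nzd: "v \<in> ?L xs" if "v \<in> carrier R" "y \<otimes> v \<in> ?L xs" for v using that by blast
    have xsy: "set (xs @ [y]) \<subseteq> \<mm>" using xs y by simp
    have "regular_sequence R (ring_module R) (xs @ [y])"
      unfolding regular_sequence_def
    proof (intro conjI allI impI ballI)
      show "set (xs @ [y]) \<subseteq> carrier R" using xsy maximal_subset by blast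
      show "?L (xs @ [y]) \<noteq> carrier (ring_module R)" using ne[OF xsy] by simp
      fix i v
      assume i: "i < length (xs @ [y])" and v: "v \<in> carrier (ring_module R)"
        and iv: "(xs @ [y]) ! i \<odot>\<^bsub>ring_module R\<^esub> v \<in> ?L (take i (xs @ [y]))"
      show "v \<in> ?L (take i (xs @ [y]))"
      proof (cases "i < length xs")
        case True
        then show ?thesis using reg v iv by (simp add: regular_sequence_def nth_append)
      next
        case False
        then have "i = length xs" using i by simp
        then show ?thesis using nzd v iv by simp
      qed
    qed
    then have "?L (xs @ [y]) \<in> ?S" using xsy by blast
    moreover have "?L xs \<subseteq> ?L (xs @ [y])"
      using xs y maximal_subset by (intro Q.list_smult_append_mono) auto
    ultimately have eq: "?L (xs @ [y]) = ?L xs" using max by simp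
    \<comment> \<open>By maximality \<open>y\<close> already lies in the ideal of \<open>xs\<close>.
      Being a nonzerodivisor modulo it, \<open>y\<close> would force one into that ideal, which is
      contained in \<open>\<mm>\<close>.\<close>
    have "y \<otimes> \<one> \<in> ?L (xs @ [y])"
      using Q.smult_mem_list_smult[of "xs @ [y]" y \<one>] xsy maximal_subset by auto
    then have "\<one> \<in> ?L xs" using nzd eq by simp
    then show False using one_L[OF xs] by blast
  qed
  then obtain s where "s \<in> carrier R - ?L xs" "\<forall>y \<in> \<mm>. y \<otimes> s \<in> ?L xs"
    using exists_socle_element[OF is_cring noetherian_ring_axioms L[OF xs] \<mm>.ideal_axioms] by blast
  then show ?thesis using that xs reg by blast
qed

text \<open>The number \<open>r\<close> is the length of the sequence from
  \<open>exists_regular_sequence_socle\<close>. The bound by the depth of \<open>R\<close> passes on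
  to every module in \<open>Deep\<close>, in particular to both cokernels.\<close>

lemma exists_not_kvanish:
  obtains r where "enat r \<le> depth R \<mm> (ring_module R)"
    "\<not> kvanish \<mm> (ring_module R) {\<zero>} r"
proof -
  interpret Q: module R "ring_module R" by (rule ring_module_is_module[OF is_cring])
  obtain xs s where xs: "set xs \<subseteq> \<mm>" "regular_sequence R (ring_module R) xs"
    and s: "s \<in> carrier R" "s \<notin> list_smult R xs (ring_module R)"
    "\<forall>y \<in> \<mm>. y \<otimes> s \<in> list_smult R xs (ring_module R)"
    by (rule exists_regular_sequence_socle)
  have "enat (length xs) \<le> depth R \<mm> (ring_module R)"
    using xs unfolding depth_def by (auto intro!: Sup_upper)
  moreover have "\<not> kvanish \<mm> (ring_module R) {\<zero>} (length xs)"
    using Q.not_kvanish_regular_sequence[OF maximal_subset xs, of s 0] s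
    by (simp add: Q.list_smult_Nil)
  ultimately show ?thesis by (rule that)
qed

end

subsection \<open>Splitting off the ring\<close>

text \<open>If f c = de, then g e is a cocycle, hence equals some du. Lifting \<open>u\<close> to
  \<open>w\<close> gives e - dw = f b, and f (db) = de = f c, so c = db. This is the injectivity of
  H^i(K) -> H^i(M) obtained from H^(i-1)(X) = 0.\<close>

lemma coboundary_lift:
  assumes modules: "module R K" "module R M" "module R X"
    and ex: "short_exact R K M X f g"
    and A: "A \<subseteq> carrier R" and van: "\<And>j. i = Suc j \<Longrightarrow> kvanish A X {\<zero>\<^bsub>X\<^esub>} j"
    and c: "c \<in> lists A \<rightarrow> carrier K" and e: "e \<in> lists A \<rightarrow> carrier M"
    and fc: "\<And>l. l \<in> lists A \<Longrightarrow> length l = i \<Longrightarrow> f (c l) = kdiff M l e"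
  shows "\<exists>b \<in> lists A \<rightarrow> carrier K. \<forall>l \<in> lists A. length l = i \<longrightarrow> c l = kdiff K l b"
proof -
  interpret f: mod_hom R K M f using modules ex by (auto intro: mod_homI simp: short_exact_def)
  interpret g: mod_hom R M X g using modules ex by (auto intro: mod_homI simp: short_exact_def)
  have inj: "inj_on f (carrier K)" and im: "f ` carrier K = {v \<in> carrier M. g v = \<zero>\<^bsub>X\<^esub>}"
    and surj: "g ` carrier M = carrier X" using ex by (simp_all add: short_exact_def)
  show ?thesis
  proof (cases i)
    case 0
    have c0: "c [] \<in> carrier K" using c by (auto simp: Pi_iff)
    have "f (c []) = f \<zero>\<^bsub>K\<^esub>" using fc[of "[]"] 0 by simp
    then have "c [] = \<zero>\<^bsub>K\<^esub>" using inj_onD[OF inj] c0 f.M.zero_closed by blast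
    then show ?thesis using 0 c by (intro bexI[OF _ c]) simp
  next
    case (Suc j)
    have ge: "(\<lambda>l. g (e l)) \<in> lists A \<rightarrow> carrier X" using e by (simp add: Pi_iff)
    have "kdiff X l (\<lambda>l. g (e l)) \<in> {\<zero>\<^bsub>X\<^esub>}" if l: "l \<in> lists A" "length l = Suc j" for l
    proof -
      have "c l \<in> carrier K" using c l(1) by blast
      then have "g (f (c l)) = \<zero>\<^bsub>X\<^esub>" using im by blast
      then show ?thesis using g.kdiff_hom[OF A l(1) e] fc[OF l(1)] l(2) Suc by simp
    qed
    then obtain u where u: "u \<in> lists A \<rightarrow> carrier X"
      and gu: "\<And>l. l \<in> lists A \<Longrightarrow> length l = j \<Longrightarrow> g (e l) \<ominus>\<^bsub>X\<^esub> kdiff X l u \<in> {\<zero>\<^bsub>X\<^esub>}"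
      using van[OF Suc] ge unfolding kvanish_def by meson
    have "\<forall>l\<in>lists A. \<exists>v. v \<in> carrier M \<and> g v = u l"
    proof
      fix l assume "l \<in> lists A"
      then have "u l \<in> g ` carrier M" using u surj by auto
      then show "\<exists>v. v \<in> carrier M \<and> g v = u l" by (metis imageE)
    qed
    then obtain w where w0: "\<And>l. l \<in> lists A \<Longrightarrow> w l \<in> carrier M \<and> g (w l) = u l" by metis
    have w: "w \<in> lists A \<rightarrow> carrier M" using w0 by simp
    note dw = f.N.cochain_kdiff[OF A w]
    \<comment> \<open>The cochain \<open>b\<close> has to lift e - dw only on words of length
      \<open>j\<close>; elsewhere zero shows that a value exists.\<close>
    define P where "P l v \<longleftrightarrow> v \<in> carrier K \<and>
      (length l = j \<longrightarrow> f v = e l \<ominus>\<^bsub>M\<^esub> kdiff M l w)" for l v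
    have "\<exists>v. P l v" if l: "l \<in> lists A" for l
    proof (cases "length l = j")
      case True
      have m: "e l \<in> carrier M" "kdiff M l w \<in> carrier M"
        using e dw l by (auto simp: Pi_iff)
      have "kdiff X l u = kdiff X l (\<lambda>l. g (w l))" using w0 by (intro g.N.kdiff_cong[OF l]) simp
      then have "kdiff X l u = g (kdiff M l w)" using g.kdiff_hom[OF A l w] by simp
      then have "g (e l \<ominus>\<^bsub>M\<^esub> kdiff M l w) = \<zero>\<^bsub>X\<^esub>" using gu[OF l True] m by simp
      then have "e l \<ominus>\<^bsub>M\<^esub> kdiff M l w \<in> f ` carrier K" using m im by simp
      then show ?thesis unfolding P_def by (metis imageE)
    next
      case False
      then show ?thesis using f.M.zero_closed unfolding P_def by blast
    qed
    then obtain b where b0: "\<And>l. l \<in> lists A \<Longrightarrow> P l (b l)" by metis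
    have b: "b \<in> lists A \<rightarrow> carrier K" using b0 by (simp add: P_def)
    have "c l = kdiff K l b" if l: "l \<in> lists A" "length l = i" for l
    proof (rule inj_onD[OF inj])
      show "c l \<in> carrier K" using c l(1) by blast
      show "kdiff K l b \<in> carrier K" using f.M.kdiff_closed[OF A b l(1)] .
      have "f (kdiff K l b) = kdiff M l (\<lambda>l. f (b l))" using f.kdiff_hom[OF A l(1) b] by simp
      also have "\<dots> = kdiff M l (\<lambda>l. e l \<ominus>\<^bsub>M\<^esub> kdiff M l w)"
        using b0 l Suc by (intro f.N.kdiff_cong[OF l(1)]) (simp add: P_def)
      also have "\<dots> = kdiff M l e"
        using f.N.kdiff_minus[OF A l(1) e dw] f.N.kdiff_kdiff[OF A l(1) w]
          f.N.kdiff_closed[OF A e l(1)] by (simp add: f.N.M.minus_zero_right)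
      finally show "f (c l) = f (kdiff K l b)" using fc[OF l] by simp
    qed
    then show ?thesis using b by blast
  qed
qed

text \<open>Naturality of the differential under the j-th projection.\<close>

lemma kdiff_module_power:
  assumes "module R M" and "A \<subseteq> carrier R" and "l \<in> lists A" and "j < n"
    and "\<And>k. k < n \<Longrightarrow> e k \<in> lists A \<rightarrow> carrier M"
  shows "kdiff (module_power M n) l (\<lambda>l. \<lambda>k\<in>{..<n}. e k l) j = kdiff M l (e j)"
proof -
  interpret p: mod_hom R "module_power M n" M "\<lambda>v. v j"
    using module_power_proj[OF assms(1,4)] .
  have "(\<lambda>l. \<lambda>k\<in>{..<n}. e k l) \<in> lists A \<rightarrow> carrier (module_power M n)"
    using assms(5) by (auto simp: Pi_iff)
  from p.kdiff_hom[OF assms(2,3) this] show ?thesis using assms(4) by simp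
qed

text \<open>A cocycle \<open>c\<close> of \<open>R\<close> becomes a coboundary in \<open>R\<^sup>p\<close> by the homotopy, hence in \<open>M\<close>, hence
  in \<open>R\<close>, the last two steps by \<open>coboundary_lift\<close>.\<close>

lemma kvanish_of_maps_into_maximal:
  assumes "cring R" and M: "module R M" and X: "module R X" and Y: "module R Y"
    and A: "A \<subseteq> carrier R"
    and f: "short_exact R (ring_module R) (module_power M n) X f f'"
    and g: "short_exact R M (module_power (ring_module R) p) Y g g'"
    and gA: "\<And>z k. z \<in> carrier M \<Longrightarrow> k < p \<Longrightarrow> g z k \<in> A"
    and van: "\<And>j. i = Suc j \<Longrightarrow> kvanish A X {\<zero>\<^bsub>X\<^esub>} j"
      "\<And>j. i = Suc j \<Longrightarrow> kvanish A Y {\<zero>\<^bsub>Y\<^esub>} j"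
  shows "kvanish A (ring_module R) {\<zero>\<^bsub>R\<^esub>} i"
  unfolding kvanish_def
proof (intro ballI impI)
  interpret cring R by fact
  interpret Q: module R "ring_module R" by (rule ring_module_is_module[OF is_cring])
  note mods = Q.module_axioms M X Y module_power_is_module[OF M, of n]
    module_power_is_module[OF Q.module_axioms, of p]
  interpret f: mod_hom R "ring_module R" "module_power M n" f
    using mods f by (auto intro: mod_homI simp: short_exact_def)
  interpret g: mod_hom R M "module_power (ring_module R) p" g
    using mods g by (auto intro: mod_homI simp: short_exact_def)
  fix c assume c: "c \<in> lists A \<rightarrow> carrier (ring_module R)"
    and cyc: "\<forall>l\<in>lists A. length l = Suc i \<longrightarrow> kdiff (ring_module R) l c \<in> {\<zero>\<^bsub>R\<^esub>}"
  have cR: "c l \<in> carrier R" if "l \<in> lists A" for l using c that by auto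
  have f1: "f \<one>\<^bsub>R\<^esub> \<in> {..<n} \<rightarrow>\<^sub>E carrier M" using f.f_im[of "\<one>\<^bsub>R\<^esub>"] by simp
  \<comment> \<open>The homotopy: on words \<open>x # l\<close> the cocycle condition makes x c the
    differential of the contraction of \<open>c\<close> with \<open>x\<close>.\<close>
  have cocycle: "x \<otimes>\<^bsub>R\<^esub> c l = kdiff (ring_module R) l (\<lambda>l. c (x # l))"
    if "x \<in> A" "l \<in> lists A" "length l = i" for x l
  proof (rule Q.M.eq_of_minus_eq_zero[simplified])
    show "x \<otimes>\<^bsub>R\<^esub> c l \<in> carrier R" using that cR A by blast
    show "kdiff (ring_module R) l (\<lambda>l. c (x # l)) \<in> carrier R"
      using Q.kdiff_closed[OF A cochain_Cons[OF c that(1)] that(2)] by simp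
    show "x \<otimes>\<^bsub>R\<^esub> c l \<ominus>\<^bsub>ring_module R\<^esub> kdiff (ring_module R) l (\<lambda>l. c (x # l)) = \<zero>\<^bsub>R\<^esub>"
      using cyc[rule_format, of "x # l"] that by simp
  qed
  \<comment> \<open>As f (c l) is \<open>c l\<close> times f(1), its j-th component is
    \<open>c l\<close> times the j-th component of f(1). Each component is first shown to be a
    coboundary in \<open>M\<close>.\<close>
  have "\<exists>b. b \<in> lists A \<rightarrow> carrier M \<and>
      (\<forall>l \<in> lists A. length l = i \<longrightarrow> c l \<odot>\<^bsub>M\<^esub> f \<one>\<^bsub>R\<^esub> j = kdiff M l b)" if j: "j < n" for j
  proof -
    have m: "f \<one>\<^bsub>R\<^esub> j \<in> carrier M" using f1 j by blast
    define w where "w = g (f \<one>\<^bsub>R\<^esub> j)"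
    have w: "w \<in> {..<p} \<rightarrow>\<^sub>E carrier R" using g.f_im[OF m] by (simp add: w_def)
    have wA: "w k \<in> A" if "k < p" for k using gA[OF m that] by (simp add: w_def)
    \<comment> \<open>The components of \<open>e\<close> are contractions of \<open>c\<close> with
      the entries of \<open>w\<close>, which are letters by \<open>gA\<close>. By
      \<open>cocycle\<close>, de is the image under \<open>g\<close> of \<open>c\<close> times the
      j-th component of f(1).\<close>
    define e where "e l = (\<lambda>k\<in>{..<p}. c (w k # l))" for l
    have ek: "(\<lambda>l. c (w k # l)) \<in> lists A \<rightarrow> carrier (ring_module R)" if "k < p" for k
      using cochain_Cons[OF c wA[OF that]] .
    have e: "e \<in> lists A \<rightarrow> carrier (module_power (ring_module R) p)"
      using ek by (auto simp: e_def Pi_iff)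
    have cm: "(\<lambda>l. c l \<odot>\<^bsub>M\<^esub> f \<one>\<^bsub>R\<^esub> j) \<in> lists A \<rightarrow> carrier M"
      using cR m by (simp add: Pi_iff)
    have "g (c l \<odot>\<^bsub>M\<^esub> f \<one>\<^bsub>R\<^esub> j) = kdiff (module_power (ring_module R) p) l e"
      if l: "l \<in> lists A" "length l = i" for l
    proof -
      have "g (c l \<odot>\<^bsub>M\<^esub> f \<one>\<^bsub>R\<^esub> j) = (\<lambda>k\<in>{..<p}. c l \<otimes>\<^bsub>R\<^esub> w k)"
        using cR[OF l(1)] m by (simp add: w_def)
      also have "\<dots> = kdiff (module_power (ring_module R) p) l e"
      proof (rule PiE_ext[of _ "{..<p}" "\<lambda>_. carrier R"])
        show "(\<lambda>k\<in>{..<p}. c l \<otimes>\<^bsub>R\<^esub> w k) \<in> {..<p} \<rightarrow>\<^sub>E carrier R"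
          using cR[OF l(1)] w by auto
        show "kdiff (module_power (ring_module R) p) l e \<in> {..<p} \<rightarrow>\<^sub>E carrier R"
          using g.N.kdiff_closed[OF A e l(1)] by simp
        fix k assume "k \<in> {..<p}"
        then have k: "k < p" by simp
        have "c l \<otimes>\<^bsub>R\<^esub> w k = w k \<otimes>\<^bsub>R\<^esub> c l" using cR[OF l(1)] wA[OF k] A by (auto intro: m_comm)
        also have "\<dots> = kdiff (ring_module R) l (\<lambda>l. c (w k # l))" by (rule cocycle[OF wA[OF k] l])
        also have "\<dots> = kdiff (module_power (ring_module R) p) l e k"
          unfolding e_def
          using kdiff_module_power[OF Q.module_axioms A l(1) k, of "\<lambda>k l. c (w k # l)"] ek by simp
        finally show "(\<lambda>k\<in>{..<p}. c l \<otimes>\<^bsub>R\<^esub> w k) k = kdiff (module_power (ring_module R) p) l e k"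
          using k by simp
      qed
      finally show ?thesis .
    qed
    from coboundary_lift[OF M mods(6) Y g A van(2) cm e this] show ?thesis by blast
  qed
  then obtain b where b: "\<And>j. j < n \<Longrightarrow> b j \<in> lists A \<rightarrow> carrier M"
    and cb: "\<And>j l. j < n \<Longrightarrow> l \<in> lists A \<Longrightarrow> length l = i \<Longrightarrow> c l \<odot>\<^bsub>M\<^esub> f \<one>\<^bsub>R\<^esub> j = kdiff M l (b j)"
    by metis
  \<comment> \<open>The cochains \<open>b j\<close> are recombined into one with values in the power
    of \<open>M\<close>; its differential is f c.\<close>
  define e where "e l = (\<lambda>j\<in>{..<n}. b j l)" for l
  have e: "e \<in> lists A \<rightarrow> carrier (module_power M n)" using b by (auto simp: e_def Pi_iff)
  have "f (c l) = kdiff (module_power M n) l e" if l: "l \<in> lists A" "length l = i" for l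
  proof -
    have "f (c l) = f (c l \<odot>\<^bsub>ring_module R\<^esub> \<one>\<^bsub>R\<^esub>)" using cR[OF l(1)] by simp
    also have "\<dots> = c l \<odot>\<^bsub>module_power M n\<^esub> f \<one>\<^bsub>R\<^esub>" using cR[OF l(1)] by (intro f.f_smult) auto
    also have "\<dots> = (\<lambda>j\<in>{..<n}. c l \<odot>\<^bsub>M\<^esub> f \<one>\<^bsub>R\<^esub> j)" by simp
    also have "\<dots> = kdiff (module_power M n) l e"
    proof (rule PiE_ext[of _ "{..<n}" "\<lambda>_. carrier M"])
      show "(\<lambda>j\<in>{..<n}. c l \<odot>\<^bsub>M\<^esub> f \<one>\<^bsub>R\<^esub> j) \<in> {..<n} \<rightarrow>\<^sub>E carrier M"
        using cR[OF l(1)] f1 by (auto intro!: g.M.smult_closed)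
      show "kdiff (module_power M n) l e \<in> {..<n} \<rightarrow>\<^sub>E carrier M"
        using f.N.kdiff_closed[OF A e l(1)] by simp
      fix j assume "j \<in> {..<n}"
      then have j: "j < n" by simp
      show "(\<lambda>j\<in>{..<n}. c l \<odot>\<^bsub>M\<^esub> f \<one>\<^bsub>R\<^esub> j) j = kdiff (module_power M n) l e j"
        unfolding e_def
        using kdiff_module_power[OF M A l(1) j, of b] b cb[OF j l] j by simp
    qed
    finally show ?thesis .
  qed
  from coboundary_lift[OF Q.module_axioms mods(5) X f A van(1) c e this]
  obtain h where h: "h \<in> lists A \<rightarrow> carrier (ring_module R)"
    and ch: "\<And>l. l \<in> lists A \<Longrightarrow> length l = i \<Longrightarrow> c l = kdiff (ring_module R) l h" by blast
  have "c l \<ominus>\<^bsub>ring_module R\<^esub> kdiff (ring_module R) l h \<in> {\<zero>\<^bsub>R\<^esub>}"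
    if "l \<in> lists A" "length l = i" for l
    using ch[OF that] cR[OF that(1)] Q.M.minus_self[of "c l"] by simp
  then show "\<exists>e\<in>lists A \<rightarrow> carrier (ring_module R). \<forall>l\<in>lists A. length l = i \<longrightarrow>
      c l \<ominus>\<^bsub>ring_module R\<^esub> kdiff (ring_module R) l e \<in> {\<zero>\<^bsub>R\<^esub>}" using h by blast
qed

text \<open>Rescaling \<open>z\<close> by the inverse of its value gives \<open>y\<close> of value
  one. Then v -> (\<phi> v, v - \<phi>(v) y) maps \<open>M\<close> to the direct sum of
  \<open>R\<close> and the kernel of \<open>\<phi>\<close>, with inverse (a, w) -> w + a y.\<close>

lemma direct_summand_of_unit:
  fixes M :: "('a, 'b) module"
  assumes "cring R" and M: "module R M" and \<phi>: "\<phi> \<in> module_hom R M (ring_module R)"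
    and z: "z \<in> carrier M" and unit: "\<phi> z \<in> Units R"
  shows "direct_summand R (ring_module R) M"
proof -
  interpret cring R by fact
  interpret \<phi>: mod_hom R M "ring_module R" \<phi>
    by (intro mod_homI M \<phi> ring_module_is_module is_cring)
  define y where "y = inv\<^bsub>R\<^esub> \<phi> z \<odot>\<^bsub>M\<^esub> z"
  have y: "y \<in> carrier M" using z unit by (simp add: y_def)
  have \<phi>y: "\<phi> y = \<one>\<^bsub>R\<^esub>" using z unit by (simp add: y_def)
  define N where "N = M\<lparr>carrier := \<phi>.ker\<rparr>"
  have N: "module R N" unfolding N_def by (intro \<phi>.M.submodule_is_module \<phi>.ker_is_submodule)
  have [simp]: "\<phi> v \<in> carrier R" if "v \<in> carrier M" for v using \<phi>.f_im[OF that] by simp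
  define h where "h v = (\<phi> v, v \<ominus>\<^bsub>M\<^esub> \<phi> v \<odot>\<^bsub>M\<^esub> y)" for v
  have ker: "v \<ominus>\<^bsub>M\<^esub> \<phi> v \<odot>\<^bsub>M\<^esub> y \<in> \<phi>.ker" if v: "v \<in> carrier M" for v
    using v y \<phi>y \<phi>.N.M.minus_self[of "\<phi> v"] by (simp add: \<phi>.ker_def)
  have add: "(v \<oplus>\<^bsub>M\<^esub> w) \<ominus>\<^bsub>M\<^esub> (\<phi> v \<oplus>\<^bsub>R\<^esub> \<phi> w) \<odot>\<^bsub>M\<^esub> y =
      (v \<ominus>\<^bsub>M\<^esub> \<phi> v \<odot>\<^bsub>M\<^esub> y) \<oplus>\<^bsub>M\<^esub> (w \<ominus>\<^bsub>M\<^esub> \<phi> w \<odot>\<^bsub>M\<^esub> y)" if "v \<in> carrier M" "w \<in> carrier M" for v w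
    using that y by (simp add: a_minus_def \<phi>.M.smult_l_distr \<phi>.M.M.minus_add \<phi>.M.M.a_ac)
  have smult: "r \<odot>\<^bsub>M\<^esub> v \<ominus>\<^bsub>M\<^esub> (r \<otimes>\<^bsub>R\<^esub> \<phi> v) \<odot>\<^bsub>M\<^esub> y = r \<odot>\<^bsub>M\<^esub> (v \<ominus>\<^bsub>M\<^esub> \<phi> v \<odot>\<^bsub>M\<^esub> y)"
    if "r \<in> carrier R" "v \<in> carrier M" for r v
    using that y by (simp add: \<phi>.M.smult_minus_distrib \<phi>.M.smult_assoc1)
  have "h \<in> module_hom R M (direct_sum (ring_module R) N)"
    using ker add smult \<phi>.f_add \<phi>.f_smult
    by (auto simp: module_hom_def direct_sum_def h_def N_def)
  moreover have "bij_betw h (carrier M) (carrier (direct_sum (ring_module R) N))"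
  proof (rule bij_betw_byWitness[where f' = "\<lambda>(a, w). w \<oplus>\<^bsub>M\<^esub> a \<odot>\<^bsub>M\<^esub> y"])
    show "\<forall>v\<in>carrier M. (\<lambda>(a, w). w \<oplus>\<^bsub>M\<^esub> a \<odot>\<^bsub>M\<^esub> y) (h v) = v"
      using y by (simp add: h_def a_minus_def \<phi>.M.M.a_assoc \<phi>.M.M.l_neg)
    show "\<forall>aw\<in>carrier (direct_sum (ring_module R) N). h ((\<lambda>(a, w). w \<oplus>\<^bsub>M\<^esub> a \<odot>\<^bsub>M\<^esub> y) aw) = aw"
      using y \<phi>y by (auto simp: h_def direct_sum_def N_def \<phi>.ker_def a_minus_def
          \<phi>.M.M.a_assoc \<phi>.M.M.r_neg)
    show "h ` carrier M \<subseteq> carrier (direct_sum (ring_module R) N)"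
      using ker by (auto simp: h_def direct_sum_def N_def)
    show "(\<lambda>(a, w). w \<oplus>\<^bsub>M\<^esub> a \<odot>\<^bsub>M\<^esub> y) ` carrier (direct_sum (ring_module R) N) \<subseteq> carrier M"
      using y by (auto simp: direct_sum_def N_def \<phi>.ker_def)
  qed
  ultimately show ?thesis
    unfolding direct_summand_def module_isomorphic_def using N by blast
qed

theorem lemma2p10:
  fixes R :: "('a, 'k) ring_scheme" and \<mm> :: "'a set" and M :: "('a, 'b) module"
  assumes "noetherian_local_ring R \<mm>"
    and "M \<in> Omega_Deep R \<mm> \<inter> DF R \<mm>"
  shows "direct_summand R (ring_module R) M"
proof -
  interpret noetherian_local_ring R \<mm> by fact
  have M: "module R M" using assms(2) by (simp add: Omega_Deep_def fg_module_def)
  obtain p g g' and Y :: "('a, (nat \<Rightarrow> 'a) set) module" where Y: "Y \<in> Deep R \<mm>"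
    and g: "short_exact R M (module_power (ring_module R) p) Y g g'"
    using assms(2) unfolding Omega_Deep_def by blast
  obtain n f f' and X :: "('a, (nat \<Rightarrow> 'b) set) module" where X: "X \<in> Deep R \<mm>"
    and f: "short_exact R (ring_module R) (module_power M n) X f f'"
    using assms(2) unfolding DF_def by blast
  have XY: "module R X" "module R Y" using X Y by (auto simp: Deep_def fg_module_def)
  obtain r where r: "enat r \<le> depth R \<mm> (ring_module R)"
    and nv: "\<not> kvanish \<mm> (ring_module R) {\<zero>\<^bsub>R\<^esub>} r" by (rule exists_not_kvanish)
  have "enat r \<le> depth R \<mm> X" "enat r \<le> depth R \<mm> Y"
    using r X Y unfolding Deep_def by (auto intro: order_trans)
  \<comment> \<open>The depth bounds make the cohomology of both cokernels vanish below degree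
    \<open>r\<close>. If all coordinates of \<open>g\<close> took values in \<open>\<mm>\<close>,
    the cohomology of \<open>R\<close> in degree \<open>r\<close> would vanish, contrary to
    \<open>nv\<close>.\<close>
  then have "\<not> (\<forall>z \<in> carrier M. \<forall>k < p. g z k \<in> \<mm>)"
    using kvanish_of_maps_into_maximal[OF is_cring M XY maximal_subset f g, of r] nv
      module.kvanish_zero_depth[OF XY(1) maximal_subset, of r]
      module.kvanish_zero_depth[OF XY(2) maximal_subset, of r] by blast
  then obtain z k where z: "z \<in> carrier M" and k: "k < p" and gz: "g z k \<notin> \<mm>" by blast
  have gh: "g \<in> module_hom R M (module_power (ring_module R) p)" using g by (simp add: short_exact_def)
  have "(\<lambda>v. g v k) \<in> module_hom R M (ring_module R)"
    using gh k by (auto simp: module_hom_def Pi_iff)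
  moreover have "g z k \<in> Units R"
    using gh k z gz by (intro Units_if_not_mem) (auto simp: module_hom_def)
  ultimately show ?thesis using direct_summand_of_unit[OF is_cring M _ z] by simp
qed

end
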